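(* Let $\Omega\subset\mathbb R^n$ be a smooth bounded domain, let $K$ be a compact set in $\Omega$ and let $V$ be a potential on $\Omega$. Assume that $\mathrm{Cap}_{V,\infty}(K)=0$. Then $C^2_c(\Omega\setminus K)$ is weakly-strongly dense in $C^2_0(\overline\Omega)$ in the sense of the potential $V$; that is, for every $\phi\in C^2_0(\overline\Omega)$ there is a sequence $(\varphi_j)_j$ in $C^2_c(\Omega\setminus K)$ which converges weakly-strongly to $\phi$ in the sense of $V$.
   Context: A potential on $\Omega$ is a measurable function $V:\Omega\to[0,+\infty]$ that is not identically zero (a.e.). For $\psi\in C^2_c(\Omega)$, $$\|\psi\|_{V,\infty}=\|\psi\|_{L^1(\Omega)}+\Big\|\frac{\nabla\psi}{\sqrt V}\Big\|_{L^\infty(\Omega)}+\Big\|\frac{\Delta\psi}{V}\Big\|_{L^\infty(\Omega)}\in[0,+\infty],$$ where a quotient is taken to be $0$ where its numerator vanishes or where $V=+\infty$, and to be $+\infty$ in absolute value where $V=0$ and the numerator is nonzero. For a compact $K\subset\Omega$, $$\mathbb B^2_K=\{\psi\in C^2_c(\Omega):\ 0\le\psi\le1,\ \psi=1\text{ in a neighborhood of }K\},\qquad \mathrm{Cap}_{V,\infty}(K)=\inf\{\|\psi\|_{V,\infty}:\ \psi\in\mathbb B^2_K\}.$$ $C^2_0(\overline\Omega)=\{\varphi\in C^2(\overline\Omega):\ \varphi=0\text{ on }\partial\Omega\}$. With $\delta(x)=\mathrm{dist}(x;\partial\Omega)$, $$L^1(V)=\Big\{g:\Omega\to\mathbb R\text{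 measurable}:\ \int_\Omega|g|V\,dx<+\infty\Big\},\qquad L^1_0(\Omega)=\Big\{g\in L^1(\Omega):\ \lim_{\varepsilon\to0}\frac1\varepsilon\int_{\{\delta\le\varepsilon\}}|g|\,dx=0\Big\}.$$ A sequence $(\varphi_j)_j$ of $C^2_0(\overline\Omega)$ converges weakly-strongly to $\phi\in C^2_0(\overline\Omega)$ in the sense of $V$ if for all $g\in L^1(V)\cap L^1_0(\Omega)$ $$0=\lim_j\int_\Omega|g|\,|\varphi_j-\phi|\,V\,dx=\lim_j\int_\Omega|g|\,|\nabla\varphi_j-\nabla\phi|\,dx=\lim_j\int_\Omega|g|\,|\Delta\varphi_j-\Delta\phi|\,dx.$$ *)

theory Defs
  imports "HOL-Analysis.Analysis" "HOL-Probability.Essential_Supremum"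
begin

definition partial_deriv :: "'a::euclidean_space \<Rightarrow> ('a \<Rightarrow> real) \<Rightarrow> 'a \<Rightarrow> real" where
  "partial_deriv i f x = frechet_derivative f (at x) i"

definition gradient :: "('a::euclidean_space \<Rightarrow> real) \<Rightarrow> 'a \<Rightarrow> 'a" where
  "gradient f x = (\<Sum>i\<in>Basis. partial_deriv i f x *\<^sub>R i)"

definition laplacian :: "('a::euclidean_space \<Rightarrow> real) \<Rightarrow> 'a \<Rightarrow> real" where
  "laplacian f x = (\<Sum>i\<in>Basis. partial_deriv i (partial_deriv i f) x)"

text \<open>Only meaningful for open \<open>U\<close>, since derivatives are taken in the whole space.\<close>

primrec Ck_on :: "nat \<Rightarrow> 'a::euclidean_space set \<Rightarrow> ('a \<Rightarrow> real) \<Rightarrow> bool" where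
  "Ck_on 0 U f \<longleftrightarrow> continuous_on U f"
| "Ck_on (Suc k) U f \<longleftrightarrow>
     (\<forall>x\<in>U. f differentiable (at x)) \<and> (\<forall>i\<in>Basis. Ck_on k U (partial_deriv i f))"

text \<open>Smoothness of the boundary is expressed by local defining functions. As the gradient
  does not vanish on \<open>U\<close>, the set \<open>frontier \<Omega> \<inter> U\<close> is exactly the zero set of \<open>\<rho>\<close> in \<open>U\<close>,
  and \<open>\<Omega>\<close> lies locally on one side of it.\<close>

definition smooth_bounded_domain :: "'a::euclidean_space set \<Rightarrow> bool" where
  "smooth_bounded_domain \<Omega> \<longleftrightarrow>
     open \<Omega> \<and> connected \<Omega> \<and> \<Omega> \<noteq> {} \<and> bounded \<Omega> \<and>
     (\<forall>p\<in>frontier \<Omega>. \<exists>U \<rho>. open U \<and> p \<in> U \<and> (\<forall>k. Ck_on k U \<rho>) \<and>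
        (\<forall>x\<in>U. gradient \<rho> x \<noteq> 0) \<and> \<Omega> \<inter> U = {x\<in>U. \<rho> x < 0})"

text \<open>Compactly supported functions are extended by zero to the whole space.\<close>

definition C2_c :: "'a::euclidean_space set \<Rightarrow> ('a \<Rightarrow> real) set" where
  "C2_c U = {\<psi>. Ck_on 2 U \<psi> \<and> compact (closure {x. \<psi> x \<noteq> 0}) \<and> closure {x. \<psi> x \<noteq> 0} \<subseteq> U}"

text \<open>\<open>C\<^sup>2\<close> up to the boundary: all derivatives of order at most two extend continuously to
  the closure. The values outside \<open>closure \<Omega>\<close> are irrelevant.\<close>

definition C2_closure :: "'a::euclidean_space set \<Rightarrow> ('a \<Rightarrow> real) set" where
  "C2_closure \<Omega> = {\<phi>. Ck_on 2 \<Omega> \<phi> \<and> continuous_on (closure \<Omega>) \<phi> \<and>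
     (\<forall>i\<in>Basis. \<exists>h. continuous_on (closure \<Omega>) h \<and> (\<forall>x\<in>\<Omega>. h x = partial_deriv i \<phi> x)) \<and>
     (\<forall>i\<in>Basis. \<forall>j\<in>Basis. \<exists>h. continuous_on (closure \<Omega>) h \<and>
        (\<forall>x\<in>\<Omega>. h x = partial_deriv j (partial_deriv i \<phi>) x))}"

definition C2_0 :: "'a::euclidean_space set \<Rightarrow> ('a \<Rightarrow> real) set" where
  "C2_0 \<Omega> = {\<phi> \<in> C2_closure \<Omega>. \<forall>x\<in>frontier \<Omega>. \<phi> x = 0}"

definition potential :: "'a::euclidean_space set \<Rightarrow> ('a \<Rightarrow> ennreal) \<Rightarrow> bool" where
  "potential \<Omega> V \<longleftrightarrow> V \<in> borel_measurable (lebesgue_on \<Omega>) \<and> \<not> (AE x in lebesgue_on \<Omega>. V x = 0)"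

definition enn_sqrt :: "ennreal \<Rightarrow> ennreal" where
  "enn_sqrt v = (if v = top then top else ennreal (sqrt (enn2real v)))"

text \<open>Division in \<^typ>\<open>ennreal\<close> satisfies \<open>0 / v = 0\<close> and \<open>a / top = 0\<close> for all \<open>a\<close> and \<open>v\<close>, and
  \<open>a / 0 = top\<close> for \<open>a \<noteq> 0\<close>, which are the required conventions for the quotients.\<close>

definition norm_V_inf :: "'a::euclidean_space set \<Rightarrow> ('a \<Rightarrow> ennreal) \<Rightarrow> ('a \<Rightarrow> real) \<Rightarrow> ennreal" where
  "norm_V_inf \<Omega> V \<psi> =
     (\<integral>\<^sup>+ x. ennreal \<bar>\<psi> x\<bar> \<partial>lebesgue_on \<Omega>)
     + esssup (lebesgue_on \<Omega>) (\<lambda>x. ennreal (norm (gradient \<psi> x)) / enn_sqrt (V x))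
     + esssup (lebesgue_on \<Omega>) (\<lambda>x. ennreal \<bar>laplacian \<psi> x\<bar> / V x)"

definition B2 :: "'a::euclidean_space set \<Rightarrow> 'a set \<Rightarrow> ('a \<Rightarrow> real) set" where
  "B2 \<Omega> K = {\<psi> \<in> C2_c \<Omega>. (\<forall>x. 0 \<le> \<psi> x \<and> \<psi> x \<le> 1) \<and>
     (\<exists>U. open U \<and> K \<subseteq> U \<and> (\<forall>x\<in>U. \<psi> x = 1))}"

definition Cap_V_inf :: "'a::euclidean_space set \<Rightarrow> ('a \<Rightarrow> ennreal) \<Rightarrow> 'a set \<Rightarrow> ennreal" where
  "Cap_V_inf \<Omega> V K = (INF \<psi>\<in>B2 \<Omega> K. norm_V_inf \<Omega> V \<psi>)"

definition L1_V :: "'a::euclidean_space set \<Rightarrow> ('a \<Rightarrow> ennreal) \<Rightarrow> ('a \<Rightarrow> real) set" where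
  "L1_V \<Omega> V = {g \<in> borel_measurable (lebesgue_on \<Omega>).
     (\<integral>\<^sup>+ x. ennreal \<bar>g x\<bar> * V x \<partial>lebesgue_on \<Omega>) < top}"

definition L1_0 :: "'a::euclidean_space set \<Rightarrow> ('a \<Rightarrow> real) set" where
  "L1_0 \<Omega> = {g. integrable (lebesgue_on \<Omega>) g \<and>
     ((\<lambda>\<epsilon>. 1 / \<epsilon> * (LINT x | lebesgue_on {x\<in>\<Omega>. infdist x (frontier \<Omega>) \<le> \<epsilon>}. \<bar>g x\<bar>))
        \<longlongrightarrow> 0) (at_right 0)}"

definition weakly_strongly_converges ::
  "'a::euclidean_space set \<Rightarrow> ('a \<Rightarrow> ennreal) \<Rightarrow> (nat \<Rightarrow> 'a \<Rightarrow> real) \<Rightarrow> ('a \<Rightarrow> real) \<Rightarrow> bool" where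
  "weakly_strongly_converges \<Omega> V \<phi>s \<phi> \<longleftrightarrow>
     (\<forall>j. \<phi>s j \<in> C2_0 \<Omega>) \<and> \<phi> \<in> C2_0 \<Omega> \<and>
     (\<forall>g \<in> L1_V \<Omega> V \<inter> L1_0 \<Omega>.
        (\<lambda>j. \<integral>\<^sup>+ x. ennreal (\<bar>g x\<bar> * \<bar>\<phi>s j x - \<phi> x\<bar>) * V x \<partial>lebesgue_on \<Omega>) \<longlonglongrightarrow> 0 \<and>
        (\<lambda>j. \<integral>\<^sup>+ x. ennreal (\<bar>g x\<bar> * norm (gradient (\<phi>s j) x - gradient \<phi> x)) \<partial>lebesgue_on \<Omega>)
           \<longlonglongrightarrow> 0 \<and>
        (\<lambda>j. \<integral>\<^sup>+ x. ennreal (\<bar>g x\<bar> * \<bar>laplacian (\<phi>s j) x - laplacian \<phi> x\<bar>) \<partial>lebesgue_on \<Omega>)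
           \<longlonglongrightarrow> 0)"

end

theory Submission
  imports Defs
begin

text \<open>
  The approximants of \<open>\<phi>\<close> are \<open>\<phi> \<theta>\<^sub>j (1 - \<psi>\<^sub>j)\<close>. Here \<open>\<theta>\<^sub>j\<close> is a cutoff that has compact support in \<open>\<Omega>\<close>
  and is 1 at distance more than \<open>\<epsilon>\<^sub>j = 1 / (j + 1)\<close> from the boundary, and \<open>\<psi>\<^sub>j\<close> is a competitor for
  the capacity of \<open>K\<close>, hence 1 near \<open>K\<close>, with norm at most \<open>\<epsilon>\<^sub>j\<close>. Multiplication by
  \<open>\<theta>\<^sub>j\<close> removes the boundary, multiplication by \<open>1 - \<psi>\<^sub>j\<close> removes \<open>K\<close>.

  Removing \<open>K\<close> costs little because the norm bound says that, almost everywhere,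
  \<open>\<bar>\<nabla>\<psi>\<^sub>j\<bar> \<le> \<epsilon>\<^sub>j \<surd>V\<close> and \<open>\<bar>\<Delta>\<psi>\<^sub>j\<bar> \<le> \<epsilon>\<^sub>j V\<close>. Both are at most \<open>\<epsilon>\<^sub>j (1 + V)\<close>, and a test function \<open>g\<close>
  is integrable against \<open>1 + V\<close>. The terms containing \<open>\<psi>\<^sub>j\<close> undifferentiated tend to 0 by dominated
  convergence, as \<open>\<psi>\<^sub>j\<close> tends to 0 almost everywhere after passing to a subsequence
  (\<open>norm_V_inf_AE\<close>, \<open>zero_capacity_sequence\<close>).

  Removing the boundary is harmless because \<open>\<phi>\<close> vanishes there and has a bounded gradient, so that
  \<open>\<bar>\<phi>\<bar>\<close> is at most a constant times the distance to the boundary (\<open>C2_0_bounds\<close>). The cutoff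
  satisfies \<open>\<bar>\<nabla>\<theta>\<^sub>j\<bar> \<le> C / \<epsilon>\<^sub>j\<close> and \<open>\<bar>\<Delta>\<theta>\<^sub>j\<bar> \<le> C / \<epsilon>\<^sub>j\<^sup>2\<close> (\<open>boundary_cutoff\<close>). Hence the gradient of \<open>\<phi> \<theta>\<^sub>j\<close>
  stays bounded, while the Laplacian is of order \<open>1 / \<epsilon>\<^sub>j\<close> in the layer of width \<open>\<epsilon>\<^sub>j\<close> along the
  boundary; the integral of \<open>\<bar>g\<bar> / \<epsilon>\<^sub>j\<close> over this layer tends to 0 by the definition of \<open>L1_0\<close>.
  The pointwise bounds are collected in \<open>cutoff_product_estimates\<close>, their integrals in
  \<open>weighted_errors_tendsto_0\<close>.

  The cutoffs are sums of tensor products of cubic B-splines over the points of a fine lattice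
  that lie well inside \<open>\<Omega>\<close>. The B-splines are twice continuously differentiable, their lattice
  translates sum to 1, and a bounded number of them overlap, so the bounds hold with a
  constant \<open>C\<close> that depends on the dimension only.
\<close>

section \<open>Calculus of partial derivatives, gradients and Laplacians\<close>

lemma partial_deriv_eqI:
  "(f has_derivative f') (at x) \<Longrightarrow> partial_deriv i f x = f' i"
  unfolding partial_deriv_def using frechet_derivative_at by metis

text \<open>The Frechet derivative, also of a function that is not differentiable, is chosen by a description
  that depends only on the germ of the function.\<close>

lemma partial_deriv_cong:
  assumes "open U" "x \<in> U" "\<And>y. y \<in> U \<Longrightarrow> f y = g y"
  shows "partial_deriv i f x = partial_deriv i g x"
proof -
  have "(f has_derivative D) (at x) \<longleftrightarrow> (g has_derivative D) (at x)" for D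
    using has_derivative_transform_within_open[OF _ assms(1,2)] assms(3) by metis
  then show ?thesis
    unfolding partial_deriv_def frechet_derivative_def by simp
qed

lemma differentiable_cong_open:
  assumes "f differentiable (at x)" "open U" "x \<in> U" "\<And>y. y \<in> U \<Longrightarrow> f y = g y"
  shows "g differentiable (at x)"
  using has_derivative_transform_within_open[OF _ assms(2,3)] assms(1,4)
  unfolding differentiable_def by metis

lemma Ck_on_cong:
  assumes "open U" "Ck_on k U f" "\<And>x. x \<in> U \<Longrightarrow> f x = g x"
  shows "Ck_on k U g"
  using assms(2,3)
proof (induction k arbitrary: f g)
  case 0
  then show ?case using continuous_on_eq by (metis Ck_on.simps(1))
next
  case (Suc k)
  have "g differentiable (at x)" if "x \<in> U" for x
    using differentiable_cong_open[OF _ assms(1) that, of f g] Suc.prems that by simp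
  moreover have "Ck_on k U (partial_deriv i g)" if "i \<in> Basis" for i
    using Suc.IH[of "partial_deriv i f" "partial_deriv i g"] Suc.prems that
      partial_deriv_cong[OF assms(1), of _ f g i] by simp
  ultimately show ?case by simp
qed

lemma Ck_on_subset: "Ck_on k U f \<Longrightarrow> W \<subseteq> U \<Longrightarrow> Ck_on k W f"
  by (induction k arbitrary: f) (auto intro: continuous_on_subset)

lemma Ck_on_Un:
  assumes "open U" "open W"
  shows "Ck_on k U f \<Longrightarrow> Ck_on k W f \<Longrightarrow> Ck_on k (U \<union> W) f"
  by (induction k arbitrary: f) (use assms in \<open>auto intro: continuous_on_open_Un\<close>)

lemma Ck_on_SucD: "Ck_on (Suc k) U f \<Longrightarrow> Ck_on k U f"
proof (induction k arbitrary: f)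
  case 0
  then show ?case
    by (auto intro!: continuous_at_imp_continuous_on differentiable_imp_continuous_within)
next
  case (Suc k)
  then show ?case by (metis Ck_on.simps(2))
qed

lemma partial_deriv_const: "partial_deriv i (\<lambda>x. c) = (\<lambda>x. 0)"
  by (rule ext, rule partial_deriv_eqI) (rule has_derivative_const)

lemma Ck_on_const: "Ck_on k U (\<lambda>x. c)"
  by (induction k arbitrary: c) (auto simp: partial_deriv_const)

lemma differentiable_has_partials:
  assumes "f differentiable (at x)"
  shows "\<exists>f'. (f has_derivative f') (at x) \<and> (\<forall>i. f' i = partial_deriv i f x)"
  using assms partial_deriv_eqI unfolding differentiable_def by metis

lemma partial_deriv_add:
  assumes "f differentiable (at x)" "g differentiable (at x)"
  shows "partial_deriv i (\<lambda>x. f x + g x) x = partial_deriv i f x + partial_deriv i g x"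
proof -
  obtain f' g' where "(f has_derivative f') (at x)" "(g has_derivative g') (at x)"
    "f' i = partial_deriv i f x" "g' i = partial_deriv i g x"
    using differentiable_has_partials[OF assms(1)] differentiable_has_partials[OF assms(2)] by blast
  then show ?thesis using partial_deriv_eqI[OF has_derivative_add] by metis
qed

lemma partial_deriv_mult:
  assumes "f differentiable (at x)" "g differentiable (at x)"
  shows "partial_deriv i (\<lambda>x. f x * g x) x = f x * partial_deriv i g x + partial_deriv i f x * g x"
proof -
  obtain f' g' where "(f has_derivative f') (at x)" "(g has_derivative g') (at x)"
    "f' i = partial_deriv i f x" "g' i = partial_deriv i g x"
    using differentiable_has_partials[OF assms(1)] differentiable_has_partials[OF assms(2)] by blast
  then show ?thesis using partial_deriv_eqI[OF has_derivative_mult] by metis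
qed

lemma Ck_on_add:
  assumes "open U"
  shows "Ck_on k U f \<Longrightarrow> Ck_on k U g \<Longrightarrow> Ck_on k U (\<lambda>x. f x + g x)"
proof (induction k arbitrary: f g)
  case 0
  then show ?case by (simp add: continuous_on_add)
next
  case (Suc k)
  have d: "f differentiable (at x)" "g differentiable (at x)" if "x \<in> U" for x
    using Suc.prems that by auto
  have "Ck_on k U (partial_deriv i (\<lambda>x. f x + g x))" if "i \<in> Basis" for i
  proof (rule Ck_on_cong[OF assms])
    show "Ck_on k U (\<lambda>x. partial_deriv i f x + partial_deriv i g x)"
      by (rule Suc.IH) (use Suc.prems that in auto)
  qed (rule partial_deriv_add[symmetric], fact d, fact d)
  moreover have "(\<lambda>x. f x + g x) differentiable (at x)" if "x \<in> U" for x
    by (rule differentiable_add) (fact d[OF that])+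
  ultimately show ?case unfolding Ck_on.simps by blast
qed

lemma Ck_on_mult:
  assumes "open U"
  shows "Ck_on k U f \<Longrightarrow> Ck_on k U g \<Longrightarrow> Ck_on k U (\<lambda>x. f x * g x)"
proof (induction k arbitrary: f g)
  case 0
  then show ?case by (simp add: continuous_on_mult)
next
  case (Suc k)
  have d: "f differentiable (at x)" "g differentiable (at x)" if "x \<in> U" for x
    using Suc.prems that by auto
  have c: "Ck_on k U f" "Ck_on k U g"
    using Suc.prems Ck_on_SucD by blast+
  have "Ck_on k U (partial_deriv i (\<lambda>x. f x * g x))" if "i \<in> Basis" for i
  proof (rule Ck_on_cong[OF assms])
    show "Ck_on k U (\<lambda>x. f x * partial_deriv i g x + partial_deriv i f x * g x)"
      by (intro Ck_on_add[OF assms] Suc.IH c) (use Suc.prems that in auto)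
  qed (rule partial_deriv_mult[symmetric], fact d, fact d)
  moreover have "(\<lambda>x. f x * g x) differentiable (at x)" if "x \<in> U" for x
    by (rule differentiable_mult) (fact d[OF that])+
  ultimately show ?case unfolding Ck_on.simps by blast
qed

text \<open>\<open>U\<close> and the complement of \<open>S\<close> form an open cover of the space, and being \<open>C\<^sup>k\<close> is a local property.
  This lets functions with compact support be handled on the whole space, where all their
  derivatives are continuous up to any boundary.\<close>

lemma Ck_on_extend_by_zero:
  assumes "open U" "closed S" "S \<subseteq> U" "Ck_on k U f" "\<And>x. x \<notin> S \<Longrightarrow> f x = 0"
  shows "Ck_on k UNIV f"
proof -
  have "Ck_on k (- S) f"
    by (rule Ck_on_cong[OF _ Ck_on_const[of k "- S" 0]]) (use assms in auto)
  moreover have "U \<union> - S = UNIV" using assms(3) by auto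
  ultimately show ?thesis
    using Ck_on_Un[of U "- S" k f] assms by auto
qed

lemma Ck_on_2_iff:
  "Ck_on 2 U f \<longleftrightarrow> (\<forall>x\<in>U. f differentiable (at x)) \<and>
     (\<forall>i\<in>Basis. (\<forall>x\<in>U. partial_deriv i f differentiable (at x)) \<and>
       (\<forall>j\<in>Basis. continuous_on U (partial_deriv j (partial_deriv i f))))"
  by (simp add: numeral_2_eq_2)

lemma Ck_on_2_continuous:
  assumes "Ck_on 2 U f"
  shows "continuous_on U f" "i \<in> Basis \<Longrightarrow> continuous_on U (partial_deriv i f)"
    and "continuous_on U (gradient f)" "continuous_on U (laplacian f)"
proof -
  have *: "Ck_on (Suc (Suc 0)) U f" using assms by (simp add: numeral_2_eq_2)
  show "continuous_on U f" using Ck_on_SucD[OF Ck_on_SucD[OF *]] by simp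
  show c: "continuous_on U (partial_deriv i f)" if "i \<in> Basis" for i
    using Ck_on_SucD[of 0 U "partial_deriv i f"] * that by simp
  show "continuous_on U (gradient f)"
    unfolding gradient_def by (intro continuous_intros c)
  show "continuous_on U (laplacian f)"
    unfolding laplacian_def using assms by (intro continuous_intros) (simp add: Ck_on_2_iff)
qed

lemma gradient_cong:
  assumes "open U" "x \<in> U" "\<And>y. y \<in> U \<Longrightarrow> f y = g y"
  shows "gradient f x = gradient g x"
  unfolding gradient_def using partial_deriv_cong[OF assms] by simp

lemma laplacian_cong:
  assumes "open U" "x \<in> U" "\<And>y. y \<in> U \<Longrightarrow> f y = g y"
  shows "laplacian f x = laplacian g x"
proof -
  have "partial_deriv i (partial_deriv i f) x = partial_deriv i (partial_deriv i g) x" for i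
    using partial_deriv_cong[OF assms(1), of _ f g i] assms
    by (intro partial_deriv_cong[OF assms(1,2)]) auto
  then show ?thesis unfolding laplacian_def by simp
qed

lemma gradient_mult:
  assumes "f differentiable (at x)" "g differentiable (at x)"
  shows "gradient (\<lambda>x. f x * g x) x = f x *\<^sub>R gradient g x + g x *\<^sub>R gradient f x"
  using assms by (simp add: gradient_def partial_deriv_mult scaleR_add_left sum.distrib
      scaleR_sum_right mult.commute)

lemma gradient_inner_Basis: "i \<in> Basis \<Longrightarrow> gradient f x \<bullet> i = partial_deriv i f x"
  unfolding gradient_def by simp

lemma laplacian_mult:
  fixes U :: "'a::euclidean_space set"
  assumes "open U" "x \<in> U" "Ck_on 2 U f" "Ck_on 2 U g"
  shows "laplacian (\<lambda>x. f x * g x) x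
    = f x * laplacian g x + 2 * (gradient f x \<bullet> gradient g x) + g x * laplacian f x"
proof -
  have "partial_deriv i (partial_deriv i (\<lambda>x. f x * g x)) x =
      f x * partial_deriv i (partial_deriv i g) x
        + 2 * ((gradient f x \<bullet> i) * (gradient g x \<bullet> i))
        + g x * partial_deriv i (partial_deriv i f) x" if "i \<in> Basis" for i
  proof -
    have d: "f differentiable (at y)" "g differentiable (at y)"
      "partial_deriv i f differentiable (at y)" "partial_deriv i g differentiable (at y)"
      if "y \<in> U" for y
      using that assms(3,4) \<open>i \<in> Basis\<close> by (auto simp: Ck_on_2_iff)
    have "partial_deriv i (partial_deriv i (\<lambda>x. f x * g x)) x
        = partial_deriv i (\<lambda>x. f x * partial_deriv i g x + partial_deriv i f x * g x) x"
      by (rule partial_deriv_cong[OF assms(1,2)]) (simp add: partial_deriv_mult d)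
    also have "\<dots> = f x * partial_deriv i (partial_deriv i g) x
        + partial_deriv i f x * partial_deriv i g x
        + (partial_deriv i f x * partial_deriv i g x
          + partial_deriv i (partial_deriv i f) x * g x)"
      using d[OF assms(2)] by (simp add: partial_deriv_add partial_deriv_mult differentiable_mult)
    finally show ?thesis
      using that by (simp add: gradient_inner_Basis algebra_simps)
  qed
  then have "laplacian (\<lambda>x. f x * g x) x =
     (\<Sum>i\<in>Basis. f x * partial_deriv i (partial_deriv i g) x
        + 2 * ((gradient f x \<bullet> i) * (gradient g x \<bullet> i))
        + g x * partial_deriv i (partial_deriv i f) x)"
    unfolding laplacian_def by simp
  also have "\<dots> = f x * laplacian g x + 2 * (gradient f x \<bullet> gradient g x) + g x * laplacian f x"
    by (simp add: laplacian_def sum.distrib sum_distrib_left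
        euclidean_inner[of "gradient f x" "gradient g x"])
  finally show ?thesis .
qed

section \<open>The cubic B-spline\<close>

text \<open>For \<open>m = 0\<close> this is the cubic B-spline with support \<open>[0, 4]\<close>, the fourth backward difference of the
  truncated power \<open>max 0 t ^ 3 / 3!\<close>; for \<open>m = 1, 2\<close> it is the \<open>m\<close>-th derivative of that
  function. A single formula covers all three because differentiation lowers the exponent of
  each truncated power by one.\<close>

definition spline :: "nat \<Rightarrow> real \<Rightarrow> real" where
  "spline m t = (\<Sum>k\<le>4. (-1) ^ k * real (4 choose k) * max 0 (t - real k) ^ (3 - m) / fact (3 - m))"

lemma has_real_derivative_truncated_power:
  "((\<lambda>t::real. max 0 (t - a) ^ Suc (Suc q)) has_real_derivative
     real (Suc (Suc q)) * max 0 (t - a) ^ Suc q) (at t)"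
proof -
  consider "t < a" | "t = a" | "t > a" by linarith
  then show ?thesis
  proof cases
    case 1
    have "((\<lambda>t. 0) has_real_derivative real (Suc (Suc q)) * max 0 (t - a) ^ Suc q) (at t)"
      using 1 by simp
    then show ?thesis
      by (rule has_field_derivative_transform_within_open[where S = "{..<a}"]) (use 1 in auto)
  next
    case 2
    have "(\<lambda>h. max 0 h ^ Suc (Suc q) / h) \<midarrow>0\<rightarrow> (0::real)"
    proof (rule Lim_null_comparison)
      show "\<forall>\<^sub>F h in at 0. norm (max 0 h ^ Suc (Suc q) / h) \<le> (\<bar>h\<bar> ^ Suc q :: real)"
      proof (intro always_eventually allI)
        fix h :: real
        have "\<bar>max 0 h\<bar> \<le> \<bar>h\<bar>" by auto
        then have "\<bar>max 0 h\<bar> ^ Suc (Suc q) \<le> \<bar>h\<bar> ^ Suc (Suc q)"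
          by (intro power_mono) auto
        then show "norm (max 0 h ^ Suc (Suc q) / h) \<le> \<bar>h\<bar> ^ Suc q"
          by (cases "h = 0") (auto simp: power_abs abs_mult divide_simps mult_ac)
      qed
      show "(\<lambda>h::real. \<bar>h\<bar> ^ Suc q) \<midarrow>0\<rightarrow> 0"
        by (auto intro!: tendsto_eq_intros)
    qed
    then show ?thesis using 2 by (simp add: DERIV_def)
  next
    case 3
    have "((\<lambda>t. t - a) has_real_derivative 1) (at t)"
      by (auto intro!: derivative_eq_intros)
    moreover have "max 0 (t - a) = t - a" using 3 by simp
    ultimately have "((\<lambda>t. (t - a) ^ Suc (Suc q)) has_real_derivative
        real (Suc (Suc q)) * max 0 (t - a) ^ Suc q) (at t)"
      using DERIV_power[of "\<lambda>t. t - a" 1 t UNIV "Suc (Suc q)"]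
      by (simp del: of_nat_Suc power_Suc)
    then show ?thesis
      by (rule has_field_derivative_transform_within_open[where S = "{a<..}"]) (use 3 in auto)
  qed
qed

lemma spline_has_derivative:
  assumes "m < 2"
  shows "(spline m has_real_derivative spline (Suc m) t) (at t)"
proof -
  obtain q where q: "3 - m = Suc (Suc q)" "3 - Suc m = Suc q"
    using assms by (metis Suc_diff_Suc Suc_lessI diff_Suc_Suc less_2_cases_iff numeral_2_eq_2
        numeral_3_eq_3 diff_zero lessI)
  have "((\<lambda>t. \<Sum>k\<le>4. (-1) ^ k * real (4 choose k) * max 0 (t - real k) ^ Suc (Suc q) / fact (Suc (Suc q)))
      has_real_derivative
      (\<Sum>k\<le>4. (-1) ^ k * real (4 choose k) * (real (Suc (Suc q)) * max 0 (t - real k) ^ Suc q)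
        / fact (Suc (Suc q)))) (at t)"
    by (intro DERIV_sum DERIV_cdivide DERIV_cmult has_real_derivative_truncated_power)
  moreover have "real (Suc (Suc q)) * y / fact (Suc (Suc q)) = y / fact (Suc q)" for y :: real
    unfolding fact_Suc[of "Suc q"] of_nat_mult by (simp del: of_nat_Suc fact_Suc)
  then have "c * (real (Suc (Suc q)) * y) / fact (Suc (Suc q)) = c * y / fact (Suc q)" for c y :: real
    by (metis mult.assoc times_divide_eq_right)
  ultimately show ?thesis
    unfolding spline_def q by (simp only:)
qed

lemma continuous_spline: "continuous_on S (spline m)"
  unfolding spline_def by (intro continuous_intros) auto

lemma spline_explicit:
  "spline 0 t = (max 0 t ^ 3 - 4 * max 0 (t - 1) ^ 3 + 6 * max 0 (t - 2) ^ 3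
     - 4 * max 0 (t - 3) ^ 3 + max 0 (t - 4) ^ 3) / 6"
  "spline 1 t = (max 0 t ^ 2 - 4 * max 0 (t - 1) ^ 2 + 6 * max 0 (t - 2) ^ 2
     - 4 * max 0 (t - 3) ^ 2 + max 0 (t - 4) ^ 2) / 2"
  "spline 2 t = max 0 t - 4 * max 0 (t - 1) + 6 * max 0 (t - 2)
     - 4 * max 0 (t - 3) + max 0 (t - 4)"
proof -
  have 4: "(\<Sum>k\<le>4. g k) = g 0 + g 1 + g 2 + g 3 + g (4::nat)" for g :: "nat \<Rightarrow> real"
    by (simp add: numeral_eq_Suc)
  have b: "(4::nat) choose 1 = 4" "(4::nat) choose 2 = 6" "(4::nat) choose 3 = 4"
    by (simp_all add: numeral_eq_Suc)
  have f: "fact 3 = (6::real)" "fact 2 = (2::real)" by (simp_all add: numeral_eq_Suc)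
  show "spline 0 t = (max 0 t ^ 3 - 4 * max 0 (t - 1) ^ 3 + 6 * max 0 (t - 2) ^ 3
     - 4 * max 0 (t - 3) ^ 3 + max 0 (t - 4) ^ 3) / 6"
    unfolding spline_def 4 b by (simp add: f field_simps)
  show "spline 1 t = (max 0 t ^ 2 - 4 * max 0 (t - 1) ^ 2 + 6 * max 0 (t - 2) ^ 2
     - 4 * max 0 (t - 3) ^ 2 + max 0 (t - 4) ^ 2) / 2"
    unfolding spline_def 4 b by (simp add: f field_simps)
  show "spline 2 t = max 0 t - 4 * max 0 (t - 1) + 6 * max 0 (t - 2)
     - 4 * max 0 (t - 3) + max 0 (t - 4)"
    unfolding spline_def 4 b by (simp add: f)
qed

text \<open>To the left of the support all truncated powers vanish; to the right of it they are genuine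
  polynomials of degree at most 3, which a fourth difference annihilates.\<close>

lemma spline_eq_0:
  assumes "m < 3" "t \<notin> {0..4}"
  shows "spline m t = 0"
proof -
  have m: "m = 0 \<or> m = 1 \<or> m = 2" using assms(1) by auto
  consider "t < 0" | "4 < t" using assms(2) by fastforce
  then show ?thesis
  proof cases
    case 1
    then show ?thesis using m by (auto simp: spline_explicit max_def simp del: One_nat_def)
  next
    case 2
    then have "max 0 t = t" "max 0 (t - 1) = t - 1" "max 0 (t - 2) = t - 2"
      "max 0 (t - 3) = t - 3" "max 0 (t - 4) = t - 4" by auto
    then show ?thesis
      using m by (auto simp: spline_explicit power2_eq_square power3_eq_cube algebra_simps
          simp del: One_nat_def)
  qed
qed

lemma sum_int_interval_telescope:
  fixes G :: "int \<Rightarrow> real"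
  assumes "a \<le> b + 1"
  shows "(\<Sum>l\<in>{a..b}. G l - G (l + 1)) = G a - G (b + 1)"
  using assms
proof (induction "b + 1" arbitrary: b rule: int_ge_induct)
  case base
  then show ?case by simp
next
  case (step i)
  have *: "{a..b} = insert b {a..b - 1}" using step by auto
  have "(\<Sum>l\<in>{a..b - 1}. G l - G (l + 1)) = G a - G b"
    using step(2)[of "b - 1"] step by simp
  then show ?case unfolding * by simp
qed

text \<open>The spline is itself a difference \<open>G t - G (t - 1)\<close>, where \<open>G\<close> rises from 0 (on \<open>t \<le> 0\<close>) to 1 (on \<open>t \<ge> 3\<close>),
  so the sum of its integer translates telescopes.\<close>

lemma spline_partition_of_unity:
  assumes "\<bar>t\<bar> + 3 \<le> real_of_int N"
  shows "(\<Sum>l\<in>{-N..N}. spline 0 (t - real_of_int l)) = 1"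
proof -
  \<comment> \<open>\<open>G\<close> is the third difference of the truncated cubic; it equals 1 once all four terms are active.\<close>
  define G :: "real \<Rightarrow> real" where
    "G t = (max 0 t ^ 3 - 3 * max 0 (t - 1) ^ 3 + 3 * max 0 (t - 2) ^ 3 - max 0 (t - 3) ^ 3) / 6" for t
  have s: "spline 0 t = G t - G (t - 1)" for t
    by (simp add: spline_explicit G_def field_simps)
  have "(\<Sum>l\<in>{-N..N}. spline 0 (t - real_of_int l))
      = (\<Sum>l\<in>{-N..N}. G (t - real_of_int l) - G (t - real_of_int (l + 1)))"
    by (simp add: s algebra_simps)
  also have "\<dots> = G (t + real_of_int N) - G (t - real_of_int (N + 1))"
    using assms by (subst sum_int_interval_telescope[of _ _ "\<lambda>l. G (t - real_of_int l)"]) auto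
  also have "G (t - real_of_int (N + 1)) = 0"
  proof -
    have "G s = 0" if "s \<le> 0" for s
      using that by (simp add: G_def)
    then show ?thesis using assms by force
  qed
  also have "G (t + real_of_int N) = 1"
  proof -
    have "G s = 1" if "3 \<le> s" for s
      using that by (simp add: G_def max_def power3_eq_cube algebra_simps)
    then show ?thesis using assms by force
  qed
  finally show ?thesis by simp
qed

lemma spline_bounded: "\<exists>C\<ge>1. \<forall>m<3. \<forall>t. \<bar>spline m t\<bar> \<le> C"
proof -
  have "\<exists>C. \<forall>t. \<bar>spline m t\<bar> \<le> C" if "m < 3" for m
  proof -
    have "bounded (spline m ` {0..4})"
      by (intro compact_imp_bounded compact_continuous_image continuous_spline) auto
    then obtain B where B: "\<And>t. t \<in> {0..4} \<Longrightarrow> \<bar>spline m t\<bar> \<le> B"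
      unfolding bounded_iff by force
    have "\<bar>spline m t\<bar> \<le> max B 0" for t
      using B[of t] spline_eq_0[OF that, of t] by (cases "t \<in> {0..4}") auto
    then show ?thesis by blast
  qed
  then obtain C where C: "\<And>m t. m < 3 \<Longrightarrow> \<bar>spline m t\<bar> \<le> C m" by metis
  have "\<bar>spline m t\<bar> \<le> Max (insert 1 (C ` {..<3}))" if "m < 3" for m t
    using C[OF that, of t] that by (auto intro: order_trans)
  then show ?thesis by (intro exI[of _ "Max (insert 1 (C ` {..<3}))"]) auto
qed

text \<open>At most five integer translates of the spline are nonzero at a given point, which makes the bound
  independent of the number \<open>N\<close> of translates.\<close>

lemma spline_sum_bounded: "\<exists>C\<ge>1. \<forall>m<3. \<forall>t N. (\<Sum>l\<in>{-N..N}. \<bar>spline m (t - real_of_int l)\<bar>) \<le> C"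
proof -
  obtain C where C: "C \<ge> 1" "\<And>m t. m < 3 \<Longrightarrow> \<bar>spline m t\<bar> \<le> C"
    using spline_bounded by blast
  have "(\<Sum>l\<in>{-N..N}. \<bar>spline m (t - real_of_int l)\<bar>) \<le> 5 * C" if "m < 3" for m t N
  proof -
    have "(\<Sum>l\<in>{-N..N}. \<bar>spline m (t - real_of_int l)\<bar>)
        = (\<Sum>l\<in>{-N..N} \<inter> {\<lfloor>t\<rfloor> - 4..\<lfloor>t\<rfloor>}. \<bar>spline m (t - real_of_int l)\<bar>)"
    proof (rule sum.mono_neutral_right)
      show "\<forall>l\<in>{-N..N} - {-N..N} \<inter> {\<lfloor>t\<rfloor> - 4..\<lfloor>t\<rfloor>}. \<bar>spline m (t - real_of_int l)\<bar> = 0"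
      proof
        fix l assume "l \<in> {-N..N} - {-N..N} \<inter> {\<lfloor>t\<rfloor> - 4..\<lfloor>t\<rfloor>}"
        then have "l < \<lfloor>t\<rfloor> - 4 \<or> \<lfloor>t\<rfloor> < l" by auto
        then have "t - real_of_int l \<notin> {0..4}" by (auto; linarith)
        then show "\<bar>spline m (t - real_of_int l)\<bar> = 0" using spline_eq_0[OF that] by simp
      qed
    qed auto
    also have "\<dots> \<le> real (card ({-N..N} \<inter> {\<lfloor>t\<rfloor> - 4..\<lfloor>t\<rfloor>})) * C"
      by (rule sum_bounded_above) (use C that in auto)
    also have "\<dots> \<le> real (card {\<lfloor>t\<rfloor> - 4..\<lfloor>t\<rfloor>}) * C"
      using C(1) by (intro mult_right_mono of_nat_mono card_mono) auto
    finally show ?thesis by simp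
  qed
  then show ?thesis using C(1) by (intro exI[of _ "5 * C"]) auto
qed

section \<open>Cutoff functions near the boundary\<close>

text \<open>A finite sum of tensor product splines, one for each lattice point of \<open>P\<close>, on the lattice of mesh
  \<open>h\<close>. The multi-index \<open>k\<close> selects a derivative of the spline in every coordinate, so that, up to
  powers of \<open>h\<close>, partial derivatives of lattice sums are again lattice sums.\<close>

definition lattice_sum ::
  "real \<Rightarrow> ('a::euclidean_space \<Rightarrow> int) set \<Rightarrow> ('a \<Rightarrow> nat) \<Rightarrow> 'a \<Rightarrow> real" where
  "lattice_sum h P k x = (\<Sum>p\<in>P. \<Prod>i\<in>Basis. spline (k i) (x \<bullet> i / h - real_of_int (p i)))"

lemma lattice_sum_has_derivative:
  fixes x :: "'a::euclidean_space"
  assumes "\<forall>i\<in>Basis. k i < 2"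
  shows "(lattice_sum h P k has_derivative
     (\<lambda>y. \<Sum>p\<in>P. \<Sum>i\<in>Basis. (spline (Suc (k i)) (x \<bullet> i / h - real_of_int (p i)) * (y \<bullet> i / h)) *
        (\<Prod>j\<in>Basis - {i}. spline (k j) (x \<bullet> j / h - real_of_int (p j))))) (at x)"
proof -
  have "((\<lambda>x. spline (k i) (x \<bullet> i / h - real_of_int c)) has_derivative
      (\<lambda>y. spline (Suc (k i)) (x \<bullet> i / h - real_of_int c) * (y \<bullet> i / h))) (at x)"
    if "i \<in> Basis" for i c
  proof -
    have "((\<lambda>x. x \<bullet> i / h - real_of_int c) has_derivative (\<lambda>y. y \<bullet> i / h)) (at x)"
      unfolding divide_inverse by (auto intro!: derivative_eq_intros)
    from DERIV_compose_FDERIV[OF spline_has_derivative this] assms that show ?thesis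
      by (simp add: mult.commute)
  qed
  then show ?thesis
    unfolding lattice_sum_def[abs_def] by (intro has_derivative_sum has_derivative_prod)
qed

lemma lattice_sum_differentiable:
  "\<forall>i\<in>Basis. k i < 2 \<Longrightarrow> lattice_sum h P k differentiable (at x)"
  using lattice_sum_has_derivative unfolding differentiable_def by blast

lemma partial_deriv_lattice_sum:
  assumes "\<forall>i\<in>Basis. k i < 2" and j: "j \<in> Basis"
  shows "partial_deriv j (lattice_sum h P k) x = lattice_sum h P (k(j := Suc (k j))) x / h"
proof -
  let ?t = "\<lambda>p i. x \<bullet> i / h - real_of_int (p i)"
  have "partial_deriv j (lattice_sum h P k) x
      = (\<Sum>p\<in>P. \<Sum>i\<in>Basis. (spline (Suc (k i)) (?t p i) * (j \<bullet> i / h)) *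
        (\<Prod>l\<in>Basis - {i}. spline (k l) (?t p l)))"
    using partial_deriv_eqI[OF lattice_sum_has_derivative[OF assms(1)]] by simp
  also have "\<dots> = (\<Sum>p\<in>P. (\<Prod>i\<in>Basis. spline ((k(j := Suc (k j))) i) (?t p i)) / h)"
  proof (rule sum.cong[OF refl])
    fix p assume "p \<in> P"
    have "(\<Sum>i\<in>Basis. (spline (Suc (k i)) (?t p i) * (j \<bullet> i / h)) *
        (\<Prod>l\<in>Basis - {i}. spline (k l) (?t p l)))
      = (\<Sum>i\<in>Basis. if i = j then spline (Suc (k i)) (?t p i) / h *
        (\<Prod>l\<in>Basis - {i}. spline (k l) (?t p l)) else 0)"
      using j by (intro sum.cong) (auto simp: inner_Basis)
    also have "\<dots> = spline (Suc (k j)) (?t p j) / h * (\<Prod>l\<in>Basis - {j}. spline (k l) (?t p l))"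
      using j by simp
    also have "(\<Prod>l\<in>Basis - {j}. spline (k l) (?t p l))
        = (\<Prod>l\<in>Basis - {j}. spline ((k(j := Suc (k j))) l) (?t p l))"
      by (intro prod.cong) auto
    also have "spline (Suc (k j)) (?t p j) / h * \<dots>
        = (\<Prod>i\<in>Basis. spline ((k(j := Suc (k j))) i) (?t p i)) / h"
      using prod.remove[OF finite_Basis j, of "\<lambda>i. spline ((k(j := Suc (k j))) i) (?t p i)"] by simp
    finally show "(\<Sum>i\<in>Basis. (spline (Suc (k i)) (?t p i) * (j \<bullet> i / h)) *
        (\<Prod>l\<in>Basis - {i}. spline (k l) (?t p l)))
      = (\<Prod>i\<in>Basis. spline ((k(j := Suc (k j))) i) (?t p i)) / h" .
  qed
  finally show ?thesis
    by (simp add: lattice_sum_def sum_divide_distrib)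
qed

lemma continuous_lattice_sum: "continuous_on S (lattice_sum h P k)"
  unfolding lattice_sum_def[abs_def] divide_inverse
  by (intro continuous_intros continuous_on_compose2[OF continuous_spline]) auto

text \<open>The sum over the full box of lattice points factorizes into one sum for each coordinate. The bound
  thus depends neither on \<open>P\<close> nor on \<open>h\<close>; this uniformity yields derivative bounds of the
  right order in \<open>h\<close>.\<close>

lemma lattice_sum_bounded:
  fixes P :: "('a::euclidean_space \<Rightarrow> int) set"
  assumes "P \<subseteq> PiE Basis (\<lambda>_. {-N..N})" "\<forall>i\<in>Basis. k i < 3"
    and "\<And>m t N. m < 3 \<Longrightarrow> (\<Sum>l\<in>{-N..N}. \<bar>spline m (t - real_of_int l)\<bar>) \<le> C"
  shows "\<bar>lattice_sum h P k x\<bar> \<le> C ^ DIM('a)"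
proof -
  let ?g = "\<lambda>p. \<Prod>i\<in>Basis. \<bar>spline (k i) (x \<bullet> i / h - real_of_int (p i))\<bar>"
  have fin: "finite (PiE (Basis::'a set) (\<lambda>_. {-N..N}))" by (intro finite_PiE) auto
  have "\<bar>lattice_sum h P k x\<bar> \<le> (\<Sum>p\<in>P. ?g p)"
    unfolding lattice_sum_def by (rule order_trans[OF sum_abs]) (simp add: abs_prod)
  also have "\<dots> \<le> (\<Sum>p\<in>PiE Basis (\<lambda>_. {-N..N}). ?g p)"
    by (rule sum_mono2[OF fin assms(1)]) (simp add: prod_nonneg)
  also have "\<dots> = (\<Prod>i\<in>Basis. \<Sum>l\<in>{-N..N}. \<bar>spline (k i) (x \<bullet> i / h - real_of_int l)\<bar>)"
    by (subst prod_sum_PiE) auto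
  also have "\<dots> \<le> (\<Prod>i\<in>(Basis::'a set). C)"
    using assms(2,3) by (intro prod_mono) (auto simp: sum_nonneg)
  finally show ?thesis by simp
qed

text \<open>A segment that leaves the set meets its boundary.\<close>

lemma in_set_of_dist_less_frontier:
  fixes \<Omega> :: "'a::euclidean_space set"
  assumes "x \<in> \<Omega>" "dist x y < infdist x (frontier \<Omega>)"
  shows "y \<in> \<Omega>"
proof (rule ccontr)
  assume "y \<notin> \<Omega>"
  then obtain z where z: "z \<in> closed_segment x y" "z \<in> frontier \<Omega>"
    using connected_Int_frontier[of "closed_segment x y" \<Omega>] assms(1) by auto
  then have "infdist x (frontier \<Omega>) \<le> dist x z" by (intro infdist_le)
  also have "\<dots> \<le> dist x y" using dist_in_closed_segment[of z x y] z(1) by (simp add: dist_commute)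
  finally show False using assms(2) by simp
qed

definition lattice_point :: "real \<Rightarrow> ('a::euclidean_space \<Rightarrow> int) \<Rightarrow> 'a" where
  "lattice_point h p = (\<Sum>i\<in>Basis. (h * real_of_int (p i)) *\<^sub>R i)"

lemma dist_lattice_point:
  fixes x :: "'a::euclidean_space"
  assumes "h > 0" "(\<Prod>i\<in>Basis. spline 0 (x \<bullet> i / h - real_of_int (p i))) \<noteq> 0"
  shows "dist x (lattice_point h p) \<le> 4 * h * DIM('a)"
proof -
  have "\<bar>(x - lattice_point h p) \<bullet> i\<bar> \<le> 4 * h" if "i \<in> Basis" for i
  proof -
    have "spline 0 (x \<bullet> i / h - real_of_int (p i)) \<noteq> 0" using assms(2) that by auto
    then have "x \<bullet> i / h - real_of_int (p i) \<in> {0..4}" using spline_eq_0[of 0] by fastforce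
    moreover have "(x - lattice_point h p) \<bullet> i = h * (x \<bullet> i / h - real_of_int (p i))"
      using that assms(1) by (simp add: lattice_point_def inner_diff_left field_simps)
    ultimately show ?thesis using assms(1) by (simp add: abs_mult)
  qed
  then have "norm (x - lattice_point h p) \<le> (\<Sum>i\<in>(Basis::'a set). 4 * h)"
    by (intro order_trans[OF norm_le_l1] sum_mono)
  then show ?thesis by (simp add: dist_norm mult.commute)
qed

lemma Ck_on_2_lattice_sum: "Ck_on 2 UNIV (lattice_sum h P (\<lambda>_. 0))"
    and gradient_lattice_sum: "norm (gradient (lattice_sum h P (\<lambda>_. 0)) x)
      \<le> (\<Sum>i\<in>Basis. \<bar>lattice_sum h P ((\<lambda>_. 0)(i := 1)) x / h\<bar>)"
    and laplacian_lattice_sum: "laplacian (lattice_sum h P (\<lambda>_. 0)) x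
      = (\<Sum>i\<in>Basis. lattice_sum h P ((\<lambda>_. 0)(i := 2)) x / h\<^sup>2)"
proof -
  have 1: "partial_deriv i (lattice_sum h P (\<lambda>_. 0)) = (\<lambda>x. (1 / h) * lattice_sum h P ((\<lambda>_. 0)(i := 1)) x)"
    if "i \<in> Basis" for i :: 'a
    using partial_deriv_lattice_sum[of "\<lambda>_. 0" i h P] that by (simp add: fun_eq_iff)
  have d: "lattice_sum h P ((\<lambda>_. 0)(i := 1)) differentiable (at x)" for i x
    by (rule lattice_sum_differentiable) auto
  have 2: "partial_deriv j (partial_deriv i (lattice_sum h P (\<lambda>_. 0)))
      = (\<lambda>x. (1 / h\<^sup>2) * lattice_sum h P (((\<lambda>_. 0)(i := 1))(j := Suc (((\<lambda>_. 0)(i := 1)) j))) x)"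
    if "i \<in> Basis" "j \<in> Basis" for i j :: 'a
  proof
    fix x
    have "\<forall>l\<in>Basis. ((\<lambda>_. 0)(i := 1)) l < (2::nat)" by simp
    from partial_deriv_lattice_sum[OF this that(2)]
    show "partial_deriv j (partial_deriv i (lattice_sum h P (\<lambda>_. 0))) x
      = (1 / h\<^sup>2) * lattice_sum h P (((\<lambda>_. 0)(i := 1))(j := Suc (((\<lambda>_. 0)(i := 1)) j))) x"
      unfolding 1[OF that(1)] partial_deriv_mult[OF differentiable_const d] partial_deriv_const
      by (simp add: power2_eq_square del: fun_upd_apply)
  qed
  have "partial_deriv i (lattice_sum h P (\<lambda>_. 0)) differentiable (at x)" if "i \<in> Basis" for i x
    unfolding 1[OF that] by (intro differentiable_mult differentiable_const d)
  moreover have "lattice_sum h P (\<lambda>_. 0) differentiable (at x)" for x :: 'a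
    by (rule lattice_sum_differentiable) simp
  moreover have "continuous_on UNIV (partial_deriv j (partial_deriv i (lattice_sum h P (\<lambda>_. 0))))"
    if "i \<in> Basis" "j \<in> Basis" for i j :: 'a
    unfolding 2[OF that] by (intro continuous_on_mult continuous_lattice_sum continuous_on_const)
  ultimately show "Ck_on 2 UNIV (lattice_sum h P (\<lambda>_. 0))"
    unfolding Ck_on_2_iff by blast
  show "norm (gradient (lattice_sum h P (\<lambda>_. 0)) x)
      \<le> (\<Sum>i\<in>Basis. \<bar>lattice_sum h P ((\<lambda>_. 0)(i := 1)) x / h\<bar>)"
    by (rule order_trans[OF norm_le_l1]) (simp add: gradient_inner_Basis 1 del: fun_upd_apply)
  have 3: "((\<lambda>_. 0)(i := 1))(i := Suc (((\<lambda>_. 0)(i := 1)) i)) = (\<lambda>_. 0)(i := 2)" for i :: 'a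
    by (rule ext) simp
  have "partial_deriv i (partial_deriv i (lattice_sum h P (\<lambda>_. 0))) x
      = lattice_sum h P ((\<lambda>_. 0)(i := 2)) x / h\<^sup>2" if "i \<in> Basis" for i :: 'a
    unfolding 2[OF that that] 3 by simp
  then show "laplacian (lattice_sum h P (\<lambda>_. 0)) x
      = (\<Sum>i\<in>Basis. lattice_sum h P ((\<lambda>_. 0)(i := 2)) x / h\<^sup>2)"
    unfolding laplacian_def by (intro sum.cong) auto
qed

text \<open>The cutoff is the lattice sum over those lattice points that lie well inside \<open>\<Omega>\<close>, with mesh
  proportional to \<open>\<epsilon>\<close>. Far from the boundary every spline that contributes is included, so the
  sum is 1 by the partition of unity; near the boundary none is. Each derivative costs one factor
  \<open>1 / h\<close>.\<close>

lemma boundary_cutoff: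
  fixes \<Omega> :: "'a::euclidean_space set"
  assumes "bounded \<Omega>"
  shows "\<exists>C\<ge>0. \<forall>\<epsilon>>0. \<exists>\<theta>. Ck_on 2 UNIV \<theta> \<and>
    compact (closure {x. \<theta> x \<noteq> 0}) \<and> closure {x. \<theta> x \<noteq> 0} \<subseteq> \<Omega> \<and>
    (\<forall>x\<in>\<Omega>. \<epsilon> < infdist x (frontier \<Omega>) \<longrightarrow> \<theta> x = 1) \<and>
    (\<forall>x. \<bar>\<theta> x\<bar> \<le> C \<and> norm (gradient \<theta> x) \<le> C / \<epsilon> \<and> \<bar>laplacian \<theta> x\<bar> \<le> C / \<epsilon>\<^sup>2)"
proof -
  obtain D where D: "D \<ge> 1"
    "\<And>m t N. m < 3 \<Longrightarrow> (\<Sum>l\<in>{-N..N}. \<bar>spline m (t - real_of_int l)\<bar>) \<le> D"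
    using spline_sum_bounded by blast
  obtain b where b: "\<And>x. x \<in> \<Omega> \<Longrightarrow> norm x \<le> b"
    using assms unfolding bounded_iff by blast
  define n where "n = real DIM('a)"
  define E where "E = D ^ DIM('a)"
  have n1: "n \<ge> 1" using DIM_positive[where 'a='a] unfolding n_def by linarith
  have E1: "E \<ge> 1" using D(1) unfolding E_def by simp
  define C where "C = 256 * n ^ 3 * E"
  have "\<exists>\<theta>. Ck_on 2 UNIV \<theta> \<and>
    compact (closure {x. \<theta> x \<noteq> 0}) \<and> closure {x. \<theta> x \<noteq> 0} \<subseteq> \<Omega> \<and>
    (\<forall>x\<in>\<Omega>. \<epsilon> < infdist x (frontier \<Omega>) \<longrightarrow> \<theta> x = 1) \<and>
    (\<forall>x. \<bar>\<theta> x\<bar> \<le> C \<and> norm (gradient \<theta> x) \<le> C / \<epsilon> \<and> \<bar>laplacian \<theta> x\<bar> \<le> C / \<epsilon>\<^sup>2)"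
    if \<epsilon>: "\<epsilon> > 0" for \<epsilon> :: real
  proof -
    \<comment> \<open>Each spline is supported within distance \<open>r = 4 h DIM('a)\<close> of its lattice point. Lattice points are
      kept if they have distance at least \<open>2 r\<close> to the boundary, which leaves the margin \<open>r\<close> for the
      support; all lattice points whose splines matter at distance more than \<open>4 r = \<epsilon>\<close> are kept.\<close>
    define r where "r = \<epsilon> / 4"
    define h where "h = \<epsilon> / (16 * n)"
    have h0: "h > 0" and r0: "r > 0" using \<epsilon> n1 by (simp_all add: h_def r_def)
    have hr: "4 * h * DIM('a) = r" using n1 by (simp add: h_def r_def n_def)
    \<comment> \<open>The box has to contain all lattice points whose spline is nonzero somewhere on \<open>\<Omega>\<close>.\<close>
    define N where "N = \<lceil>b / h\<rceil> + 3"
    define box where "box = PiE (Basis :: 'a set) (\<lambda>_. {-N..N})"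
    define P where "P = {p \<in> box. lattice_point h p \<in> \<Omega> \<and>
      2 * r \<le> infdist (lattice_point h p) (frontier \<Omega>)}"
    define \<theta> where "\<theta> = lattice_sum h P (\<lambda>_. 0)"
    have Pbox: "P \<subseteq> box" by (auto simp: P_def)
    have fin: "finite box" unfolding box_def by (intro finite_PiE) auto
    have bd: "\<bar>lattice_sum h P k x\<bar> \<le> E" if "\<forall>i\<in>Basis. k i < 3" for k x
      unfolding E_def
      by (rule lattice_sum_bounded[OF Pbox[unfolded box_def] that D(2)])
    have support: "x \<in> \<Omega> \<and> r \<le> infdist x (frontier \<Omega>)" if nz: "\<theta> x \<noteq> 0" for x
    proof -
      obtain p where p: "p \<in> P" "(\<Prod>i\<in>Basis. spline 0 (x \<bullet> i / h - real_of_int (p i))) \<noteq> 0"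
        using nz unfolding \<theta>_def lattice_sum_def
        by (rule sum.not_neutral_contains_not_neutral)
      let ?q = "lattice_point h p"
      have d: "dist ?q x \<le> r"
        using dist_lattice_point[OF h0 p(2)] hr by (simp add: dist_commute)
      have q: "?q \<in> \<Omega>" "2 * r \<le> infdist ?q (frontier \<Omega>)" using p(1) by (auto simp: P_def)
      have "x \<in> \<Omega>" by (rule in_set_of_dist_less_frontier[OF q(1)]) (use d q r0 in linarith)
      then show ?thesis using infdist_triangle[of ?q "frontier \<Omega>" x] d q by linarith
    qed
    have closed: "closed {x \<in> closure \<Omega>. r \<le> infdist x (frontier \<Omega>)}"
      by (intro closed_Collect_conj closed_Collect_le continuous_intros) auto
    have sub: "closure {x. \<theta> x \<noteq> 0} \<subseteq> {x \<in> closure \<Omega>. r \<le> infdist x (frontier \<Omega>)}"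
      by (rule closure_minimal[OF _ closed]) (use support closure_subset in auto)
    have "x \<in> \<Omega>" if "x \<in> closure \<Omega>" "r \<le> infdist x (frontier \<Omega>)" for x
    proof (rule ccontr)
      assume "x \<notin> \<Omega>"
      then have "x \<in> frontier \<Omega>" using that interior_subset[of \<Omega>] by (auto simp: frontier_def)
      then show False using that(2) r0 by simp
    qed
    with sub have sub\<Omega>: "closure {x. \<theta> x \<noteq> 0} \<subseteq> \<Omega>" by auto
    have comp: "compact (closure {x. \<theta> x \<noteq> 0})"
      using sub\<Omega> assms bounded_subset by (auto simp: compact_eq_bounded_closed)
    have one: "\<theta> x = 1" if x: "x \<in> \<Omega>" "\<epsilon> < infdist x (frontier \<Omega>)" for x
    proof -
      have "\<theta> x = (\<Sum>p\<in>box. \<Prod>i\<in>Basis. spline 0 (x \<bullet> i / h - real_of_int (p i)))"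
        unfolding \<theta>_def lattice_sum_def
      proof (rule sum.mono_neutral_left[OF fin Pbox], rule ballI, rule ccontr)
        fix p assume p: "p \<in> box - P" "(\<Prod>i\<in>Basis. spline 0 (x \<bullet> i / h - real_of_int (p i))) \<noteq> 0"
        let ?q = "lattice_point h p"
        have d: "dist x ?q \<le> r" using dist_lattice_point[OF h0 p(2)] hr by simp
        have e: "4 * r < infdist x (frontier \<Omega>)" using x(2) by (simp add: r_def)
        have "?q \<in> \<Omega>" by (rule in_set_of_dist_less_frontier[OF x(1)]) (use d e r0 in linarith)
        moreover have "2 * r \<le> infdist ?q (frontier \<Omega>)"
          using infdist_triangle[of x "frontier \<Omega>" ?q] d e r0 by linarith
        ultimately show False using p(1) by (auto simp: P_def)
      qed
      also have "\<dots> = (\<Prod>i\<in>Basis. \<Sum>l\<in>{-N..N}. spline 0 (x \<bullet> i / h - real_of_int l))"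
        unfolding box_def by (subst prod_sum_PiE) auto
      also have "\<dots> = 1"
      proof (rule prod.neutral, rule ballI, rule spline_partition_of_unity)
        fix i :: 'a assume "i \<in> Basis"
        then have "\<bar>x \<bullet> i\<bar> \<le> b" using Basis_le_norm[of i x] b[OF x(1)] by linarith
        then have "\<bar>x \<bullet> i / h\<bar> \<le> b / h" using h0 by (simp add: divide_right_mono)
        then show "\<bar>x \<bullet> i / h\<bar> + 3 \<le> real_of_int N" unfolding N_def by linarith
      qed
      finally show ?thesis .
    qed
    have nn: "n \<le> n ^ 2" "n ^ 2 \<le> n ^ 3" "1 \<le> n ^ 3"
      using n1 by (auto simp: self_le_power power_increasing)
    have "\<bar>\<theta> x\<bar> \<le> C" for x
    proof -
      have "\<bar>\<theta> x\<bar> \<le> E" unfolding \<theta>_def by (rule bd) simp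
      also have "\<dots> \<le> C" unfolding C_def using nn E1 by simp
      finally show ?thesis .
    qed
    moreover have "norm (gradient \<theta> x) \<le> C / \<epsilon>" for x
    proof -
      have "norm (gradient \<theta> x) \<le> (\<Sum>i\<in>(Basis::'a set). \<bar>lattice_sum h P ((\<lambda>_. 0)(i := 1)) x / h\<bar>)"
        unfolding \<theta>_def by (rule gradient_lattice_sum)
      also have "\<dots> \<le> (\<Sum>i\<in>(Basis::'a set). E / h)"
        using h0 by (intro sum_mono) (auto intro!: divide_right_mono bd)
      also have "\<dots> = 16 * n\<^sup>2 * E / \<epsilon>"
        by (simp add: n_def h_def power2_eq_square)
      also have "\<dots> \<le> C / \<epsilon>"
        unfolding C_def using nn(2) n1 E1 \<epsilon> by (intro divide_right_mono mult_mono) auto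
      finally show ?thesis .
    qed
    moreover have "\<bar>laplacian \<theta> x\<bar> \<le> C / \<epsilon>\<^sup>2" for x
    proof -
      have "\<bar>laplacian \<theta> x\<bar> \<le> (\<Sum>i\<in>(Basis::'a set). \<bar>lattice_sum h P ((\<lambda>_. 0)(i := 2)) x / h\<^sup>2\<bar>)"
        unfolding \<theta>_def laplacian_lattice_sum by (rule sum_abs)
      also have "\<dots> \<le> (\<Sum>i\<in>(Basis::'a set). E / h\<^sup>2)"
        using h0 by (intro sum_mono) (auto intro!: divide_right_mono bd)
      also have "\<dots> = C / \<epsilon>\<^sup>2"
        by (simp add: n_def h_def C_def power2_eq_square power3_eq_cube)
      finally show ?thesis .
    qed
    ultimately show ?thesis
      using comp sub\<Omega> one Ck_on_2_lattice_sum[of h P] unfolding \<theta>_def[symmetric] by blast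
  qed
  moreover have "C \<ge> 0" unfolding C_def using n1 E1 by simp
  ultimately show ?thesis by blast
qed

section \<open>Functions vanishing on the boundary and functions with compact support\<close>

lemma has_derivative_gradient:
  fixes f :: "'a::euclidean_space \<Rightarrow> real"
  assumes "f differentiable (at x)"
  shows "(f has_derivative (\<lambda>v. gradient f x \<bullet> v)) (at x)"
proof -
  obtain f' where f': "(f has_derivative f') (at x)" "\<And>i. f' i = partial_deriv i f x"
    using differentiable_has_partials[OF assms] by blast
  interpret linear f' using f'(1) by (rule has_derivative_linear)
  have "f' v = gradient f x \<bullet> v" for v
  proof -
    have "f' v = f' (\<Sum>i\<in>Basis. (v \<bullet> i) *\<^sub>R i)" by (simp add: euclidean_representation)
    also have "\<dots> = gradient f x \<bullet> v"
      unfolding sum scale unfolding f'(2) gradient_def inner_sum_left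
      by (simp add: inner_commute mult.commute)
    finally show ?thesis .
  qed
  then show ?thesis using f'(1) by (metis ext)
qed

text \<open>The segment from \<open>x\<close> to a nearest boundary point stays in \<open>\<Omega>\<close> except for its endpoint, where \<open>f\<close>
  vanishes; the mean value theorem along it gives the bound.\<close>

lemma vanishing_on_frontier_le_infdist:
  fixes f :: "'a::euclidean_space \<Rightarrow> real"
  assumes \<Omega>: "open \<Omega>" "bounded \<Omega>" and x: "x \<in> \<Omega>"
    and diff: "\<And>y. y \<in> \<Omega> \<Longrightarrow> f differentiable (at y)"
    and cont: "continuous_on (closure \<Omega>) f"
    and zero: "\<And>y. y \<in> frontier \<Omega> \<Longrightarrow> f y = 0"
    and bd: "\<And>y. y \<in> \<Omega> \<Longrightarrow> norm (gradient f y) \<le> M"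
  shows "\<bar>f x\<bar> \<le> M * infdist x (frontier \<Omega>)"
proof -
  have "frontier \<Omega> \<noteq> {}"
    using x \<Omega>(2) not_bounded_UNIV[where 'a = 'a] by (auto simp: frontier_eq_empty)
  then obtain p where p: "p \<in> frontier \<Omega>" "infdist x (frontier \<Omega>) = dist x p"
    using infdist_attains_inf[OF frontier_closed] by metis
  let ?\<gamma> = "\<lambda>t. x + t *\<^sub>R (p - x)"
  have "x \<noteq> p" using p(1) x \<Omega>(1) by (auto simp: frontier_def interior_open)
  then have dpos: "dist x p > 0" by simp
  have in\<Omega>: "?\<gamma> t \<in> \<Omega>" if "0 \<le> t" "t < 1" for t
  proof (rule in_set_of_dist_less_frontier[OF x])
    have "dist x (?\<gamma> t) = t * dist x p"
      using that by (simp add: dist_norm norm_minus_commute)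
    then show "dist x (?\<gamma> t) < infdist x (frontier \<Omega>)" using p(2) dpos that by simp
  qed
  have in_closure: "?\<gamma> t \<in> closure \<Omega>" if "0 \<le> t" "t \<le> 1" for t
    using in\<Omega>[of t] that p(1) closure_subset[of \<Omega>] by (cases "t = 1") (auto simp: frontier_def)
  have "\<exists>t\<in>{0<..<1}. norm (f (?\<gamma> 1) - f (?\<gamma> 0)) \<le> norm (gradient f (?\<gamma> t) \<bullet> ((1 - 0) *\<^sub>R (p - x)))"
  proof (rule mvt_general)
    show "continuous_on {0..1} (\<lambda>t. f (?\<gamma> t))"
      by (rule continuous_on_compose2[OF cont]) (use in_closure in \<open>auto intro!: continuous_intros\<close>)
    fix t :: real assume t: "0 < t" "t < 1"
    have "(?\<gamma> has_derivative (\<lambda>s. s *\<^sub>R (p - x))) (at t)"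
      by (auto intro!: derivative_eq_intros)
    from has_derivative_compose[OF this has_derivative_gradient[OF diff[OF in\<Omega>[of t]]]] t
    show "((\<lambda>t. f (?\<gamma> t)) has_derivative (\<lambda>s. gradient f (?\<gamma> t) \<bullet> (s *\<^sub>R (p - x)))) (at t)"
      by simp
  qed simp
  then obtain t where t: "0 < t" "t < 1" "\<bar>f x\<bar> \<le> \<bar>gradient f (?\<gamma> t) \<bullet> (p - x)\<bar>"
    using zero[OF p(1)] by auto
  note t(3)
  also have "\<bar>gradient f (?\<gamma> t) \<bullet> (p - x)\<bar> \<le> norm (gradient f (?\<gamma> t)) * norm (p - x)"
    by (rule Cauchy_Schwarz_ineq2)
  also have "\<dots> \<le> M * norm (p - x)"
    using bd[OF in\<Omega>[of t]] t by (intro mult_right_mono) auto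
  finally show ?thesis by (simp add: p(2) dist_norm norm_minus_commute)
qed

text \<open>The linear decay at the boundary is what compensates for the factor \<open>1 / \<epsilon>\<close> that is lost when a
  cutoff at scale \<open>\<epsilon>\<close> is differentiated.\<close>

lemma C2_0_bounds:
  fixes \<Omega> :: "'a::euclidean_space set"
  assumes \<Omega>: "open \<Omega>" "bounded \<Omega>" and \<phi>: "\<phi> \<in> C2_0 \<Omega>"
  shows "\<exists>M\<ge>0. \<forall>x\<in>\<Omega>. \<bar>\<phi> x\<bar> \<le> M \<and> \<bar>\<phi> x\<bar> \<le> M * infdist x (frontier \<Omega>) \<and>
    norm (gradient \<phi> x) \<le> M \<and> \<bar>laplacian \<phi> x\<bar> \<le> M"
proof -
  have extend: "\<exists>B. \<forall>x\<in>\<Omega>. \<bar>f x\<bar> \<le> B"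
    if ext: "\<exists>h. continuous_on (closure \<Omega>) h \<and> (\<forall>x\<in>\<Omega>. h x = f x)" for f :: "'a \<Rightarrow> real"
  proof -
    obtain h where h: "continuous_on (closure \<Omega>) h" "\<And>x. x \<in> \<Omega> \<Longrightarrow> h x = f x"
      using ext by blast
    have "bounded (h ` closure \<Omega>)"
      by (intro compact_imp_bounded compact_continuous_image h(1)) (simp add: \<Omega>(2))
    then obtain B where B: "\<And>x. x \<in> closure \<Omega> \<Longrightarrow> \<bar>h x\<bar> \<le> B"
      unfolding bounded_iff by force
    have "\<bar>f x\<bar> \<le> B" if "x \<in> \<Omega>" for x
      using B[of x] h(2)[OF that] closure_subset[of \<Omega>] that by auto
    then show ?thesis by blast
  qed
  have C: "Ck_on 2 \<Omega> \<phi>" "continuous_on (closure \<Omega>) \<phi>" and zero: "\<And>x. x \<in> frontier \<Omega> \<Longrightarrow> \<phi> x = 0"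
    and C1: "\<And>i. i \<in> Basis \<Longrightarrow> \<exists>h. continuous_on (closure \<Omega>) h \<and> (\<forall>x\<in>\<Omega>. h x = partial_deriv i \<phi> x)"
    and C2: "\<And>i. i \<in> Basis \<Longrightarrow> \<exists>h. continuous_on (closure \<Omega>) h \<and>
        (\<forall>x\<in>\<Omega>. h x = partial_deriv i (partial_deriv i \<phi>) x)"
    using \<phi> by (simp_all add: C2_0_def C2_closure_def)
  obtain B0 where B0: "\<And>x. x \<in> \<Omega> \<Longrightarrow> \<bar>\<phi> x\<bar> \<le> B0"
    using extend[of \<phi>, OF exI[of _ \<phi>]] C(2) by auto
  have "\<forall>i\<in>Basis. \<exists>B. \<forall>x\<in>\<Omega>. \<bar>partial_deriv i \<phi> x\<bar> \<le> B"
    by (intro ballI extend[of "partial_deriv i \<phi>" for i, OF C1])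
  from bchoice[OF this] obtain B1 where
    B1: "\<And>i x. i \<in> Basis \<Longrightarrow> x \<in> \<Omega> \<Longrightarrow> \<bar>partial_deriv i \<phi> x\<bar> \<le> B1 i"
    by auto
  have "\<forall>i\<in>Basis. \<exists>B. \<forall>x\<in>\<Omega>. \<bar>partial_deriv i (partial_deriv i \<phi>) x\<bar> \<le> B"
    by (intro ballI extend[of "partial_deriv i (partial_deriv i \<phi>)" for i, OF C2])
  from bchoice[OF this] obtain B2 where
    B2: "\<And>i x. i \<in> Basis \<Longrightarrow> x \<in> \<Omega> \<Longrightarrow> \<bar>partial_deriv i (partial_deriv i \<phi>) x\<bar> \<le> B2 i"
    by auto
  define G where "G = (\<Sum>i\<in>Basis. B1 i)"
  have G: "norm (gradient \<phi> x) \<le> G" if "x \<in> \<Omega>" for x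
  proof -
    have "norm (gradient \<phi> x) \<le> (\<Sum>i\<in>Basis. \<bar>partial_deriv i \<phi> x\<bar>)"
      by (rule order_trans[OF norm_le_l1]) (simp add: gradient_inner_Basis)
    also have "\<dots> \<le> G" unfolding G_def by (intro sum_mono B1 that)
    finally show ?thesis .
  qed
  have L: "\<bar>laplacian \<phi> x\<bar> \<le> (\<Sum>i\<in>Basis. B2 i)" if "x \<in> \<Omega>" for x
    unfolding laplacian_def by (rule order_trans[OF sum_abs]) (intro sum_mono B2 that)
  have D: "\<bar>\<phi> x\<bar> \<le> G * infdist x (frontier \<Omega>)" if "x \<in> \<Omega>" for x
    by (rule vanishing_on_frontier_le_infdist[OF \<Omega> that _ C(2) zero G])
      (use C(1) in \<open>simp add: Ck_on_2_iff\<close>)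
  define M where "M = max 0 (max B0 (max G (\<Sum>i\<in>Basis. B2 i)))"
  have "G * infdist x (frontier \<Omega>) \<le> M * infdist x (frontier \<Omega>)" for x
    by (rule mult_right_mono) (auto simp: M_def infdist_nonneg)
  moreover have "B0 \<le> M" "G \<le> M" "(\<Sum>i\<in>Basis. B2 i) \<le> M" "0 \<le> M" by (auto simp: M_def)
  ultimately have "\<bar>\<phi> x\<bar> \<le> M \<and> \<bar>\<phi> x\<bar> \<le> M * infdist x (frontier \<Omega>) \<and>
      norm (gradient \<phi> x) \<le> M \<and> \<bar>laplacian \<phi> x\<bar> \<le> M" if "x \<in> \<Omega>" for x
    using order_trans[OF B0[OF that]] order_trans[OF G[OF that]] order_trans[OF L[OF that]]
      order_trans[OF D[OF that]] by simp
  with \<open>0 \<le> M\<close> show ?thesis by blast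
qed

lemma Ck_on_UNIV_of_C2_c: "open U \<Longrightarrow> \<psi> \<in> C2_c U \<Longrightarrow> Ck_on 2 UNIV \<psi>"
  using Ck_on_extend_by_zero[of U "closure {x. \<psi> x \<noteq> 0}" 2 \<psi>] closure_subset[of "{x. \<psi> x \<noteq> 0}"]
  unfolding C2_c_def by blast

lemma C2_c_subset_C2_0:
  assumes "open U" "U \<subseteq> \<Omega>" "open \<Omega>"
  shows "C2_c U \<subseteq> C2_0 \<Omega>"
proof
  fix f assume f: "f \<in> C2_c U"
  have C: "Ck_on 2 UNIV f" by (rule Ck_on_UNIV_of_C2_c[OF assms(1) f])
  have "f x = 0" if "x \<in> frontier \<Omega>" for x
  proof (rule ccontr)
    assume "f x \<noteq> 0"
    then have "x \<in> \<Omega>" using f assms(2) closure_subset[of "{x. f x \<noteq> 0}"] by (auto simp: C2_c_def)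
    then show False using that assms(3) by (simp add: frontier_def interior_open)
  qed
  moreover have "\<exists>h. continuous_on (closure \<Omega>) h \<and> (\<forall>x\<in>\<Omega>. h x = g x)"
    if "continuous_on UNIV g" for g :: "'a \<Rightarrow> real"
    using continuous_on_subset[OF that] by blast
  moreover have "continuous_on UNIV (partial_deriv i f)"
    "continuous_on UNIV (partial_deriv j (partial_deriv i f))"
    if "i \<in> Basis" "j \<in> Basis" for i j
    using Ck_on_2_continuous(2)[OF C] C that unfolding Ck_on_2_iff by blast+
  moreover have "Ck_on 2 \<Omega> f" "continuous_on (closure \<Omega>) f"
    using Ck_on_subset[OF C] continuous_on_subset[OF Ck_on_2_continuous(1)[OF C]] by blast+
  ultimately show "f \<in> C2_0 \<Omega>"
    unfolding C2_0_def C2_closure_def by blast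
qed

lemma derivatives_one_minus:
  assumes "Ck_on 2 UNIV \<psi>"
  shows "Ck_on 2 UNIV (\<lambda>x. 1 - \<psi> x)"
    and "gradient (\<lambda>x. 1 - \<psi> x) x = - gradient \<psi> x"
    and "laplacian (\<lambda>x. 1 - \<psi> x) x = - laplacian \<psi> x"
proof -
  have e: "(\<lambda>x. 1 - \<psi> x) = (\<lambda>x. 1 + (-1) * \<psi> x)" by auto
  have m: "Ck_on 2 UNIV (\<lambda>x. (-1) * \<psi> x)"
    by (intro Ck_on_mult Ck_on_const assms) auto
  show "Ck_on 2 UNIV (\<lambda>x. 1 - \<psi> x)"
    unfolding e by (intro Ck_on_add m Ck_on_const) auto
  have d: "\<psi> differentiable (at x)" "partial_deriv i \<psi> differentiable (at x)" if "i \<in> Basis" for i x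
    using assms that by (auto simp: Ck_on_2_iff)
  have neg: "partial_deriv i (\<lambda>x. c + (-1) * f x) x = (-1) * partial_deriv i f x"
    if "f differentiable (at x)" for c f i and x :: 'a
    using partial_deriv_add[of "\<lambda>_. c" x "\<lambda>x. (-1) * f x" i]
      partial_deriv_mult[of "\<lambda>_. -1" x f i] that
    by (simp add: partial_deriv_const differentiable_minus)
  have p: "partial_deriv i (\<lambda>x. 1 - \<psi> x) = (\<lambda>x. 0 + (-1) * partial_deriv i \<psi> x)" if "i \<in> Basis" for i
  proof
    fix x show "partial_deriv i (\<lambda>x. 1 - \<psi> x) x = 0 + (-1) * partial_deriv i \<psi> x"
      using neg[OF d(1)[OF that, of x], of i 1] by simp
  qed
  show "gradient (\<lambda>x. 1 - \<psi> x) x = - gradient \<psi> x"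
    by (simp add: gradient_def p sum_negf)
  have "partial_deriv i (partial_deriv i (\<lambda>x. 1 - \<psi> x)) x = - partial_deriv i (partial_deriv i \<psi>) x"
    if "i \<in> Basis" for i
    unfolding p[OF that] using neg[OF d(2)[OF that], of i 0] by simp
  then show "laplacian (\<lambda>x. 1 - \<psi> x) x = - laplacian \<psi> x"
    by (simp add: laplacian_def sum_negf)
qed

section \<open>Pointwise estimates for the truncated functions\<close>

text \<open>The pointwise core of the proof. Write \<open>f = \<phi> \<theta>\<close>. Outside the boundary layer \<open>f\<close> agrees with \<open>\<phi>\<close> near
  \<open>x\<close>. Inside it \<open>\<bar>\<phi>\<bar> \<le> M \<epsilon>\<close>, so in the gradient of \<open>f\<close> the factor \<open>1 / \<epsilon>\<close> coming from \<open>\<theta>\<close>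
  cancels, and in the Laplacian only one such factor survives. Since \<open>u = f (1 - \<psi>)\<close>, all other
  error terms carry \<open>\<psi>\<close>, its gradient or its Laplacian as a factor. The last estimate is the
  reason why the definition of \<open>L1_0\<close> divides the integral over the boundary layer by its width.\<close>

lemma cutoff_product_estimates:
  fixes \<Omega> :: "'a::euclidean_space set"
  assumes \<Omega>: "open \<Omega>" and x: "x \<in> \<Omega>" and \<epsilon>: "0 < \<epsilon>" "\<epsilon> \<le> 1"
    and \<phi>: "Ck_on 2 \<Omega> \<phi>" "\<bar>\<phi> x\<bar> \<le> M" "\<bar>\<phi> x\<bar> \<le> M * infdist x (frontier \<Omega>)"
      "norm (gradient \<phi> x) \<le> M" "\<bar>laplacian \<phi> x\<bar> \<le> M"
    and \<theta>: "Ck_on 2 UNIV \<theta>" "\<And>y. y \<in> \<Omega> \<Longrightarrow> \<epsilon> < infdist y (frontier \<Omega>) \<Longrightarrow> \<theta> y = 1"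
      "\<bar>\<theta> x\<bar> \<le> C" "norm (gradient \<theta> x) \<le> C / \<epsilon>" "\<bar>laplacian \<theta> x\<bar> \<le> C / \<epsilon>\<^sup>2"
    and \<psi>: "Ck_on 2 UNIV \<psi>" "0 \<le> \<psi> x" "\<psi> x \<le> 1"
    and \<kappa>: "\<kappa> = (if infdist x (frontier \<Omega>) \<le> \<epsilon> then 1 else 0)"
    and u: "u = (\<lambda>x. \<phi> x * \<theta> x * (1 - \<psi> x))"
    and A: "A = 8 * C * M + 2 * M"
  shows "\<bar>u x - \<phi> x\<bar> \<le> A * (\<kappa> + \<psi> x)"
    and "norm (gradient u x - gradient \<phi> x) \<le> A * (\<kappa> / \<epsilon> + \<psi> x + norm (gradient \<psi> x) + \<bar>laplacian \<psi> x\<bar>)"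
    and "\<bar>laplacian u x - laplacian \<phi> x\<bar> \<le> A * (\<kappa> / \<epsilon> + \<psi> x + norm (gradient \<psi> x) + \<bar>laplacian \<psi> x\<bar>)"
proof -
  let ?d = "infdist x (frontier \<Omega>)"
  define f where "f = (\<lambda>x. \<phi> x * \<theta> x)"
  \<comment> \<open>\<open>B\<close> bounds \<open>f\<close>, its gradient, its distance to \<open>\<phi>\<close> in \<open>C\<^sup>1\<close>, and \<open>\<epsilon>\<close> times the distance of the Laplacians.\<close>
  define B where "B = 4 * (C * M) + M"
  have M0: "0 \<le> M" and C0: "0 \<le> C" using \<phi>(2) \<theta>(3) by linarith+
  then have CM: "0 \<le> C * M" "C * M \<le> B" "M \<le> B" "M + C * M \<le> B" by (simp_all add: B_def)
  have \<theta>\<Omega>: "Ck_on 2 \<Omega> \<theta>" by (rule Ck_on_subset[OF \<theta>(1)]) simp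
  have diff: "\<phi> differentiable (at x)" "\<theta> differentiable (at x)"
    using \<phi>(1) \<theta>\<Omega> x by (simp_all add: Ck_on_2_iff)
  have f2: "Ck_on 2 \<Omega> f" unfolding f_def by (rule Ck_on_mult[OF \<Omega> \<phi>(1) \<theta>\<Omega>])
  have f_abs: "\<bar>f x\<bar> \<le> C * M"
    unfolding f_def abs_mult using mult_mono[OF \<phi>(2) \<theta>(3)] M0 by (simp add: mult.commute)
  have f: "\<bar>f x - \<phi> x\<bar> \<le> B * \<kappa> \<and> norm (gradient f x) \<le> B \<and>
      norm (gradient f x - gradient \<phi> x) \<le> B * \<kappa> \<and>
      \<bar>laplacian f x - laplacian \<phi> x\<bar> \<le> B * (\<kappa> / \<epsilon>) \<and> \<bar>laplacian f x\<bar> \<le> B * (\<kappa> / \<epsilon>) + B"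
  proof (cases "?d \<le> \<epsilon>")
    case False
    let ?U = "\<Omega> \<inter> {y. \<epsilon> < infdist y (frontier \<Omega>)}"
    have "open ?U"
      by (intro open_Int \<Omega> open_Collect_less continuous_intros)
    moreover have "x \<in> ?U" using x False by simp
    moreover have "f y = \<phi> y" if "y \<in> ?U" for y using \<theta>(2) that by (simp add: f_def)
    ultimately have "gradient f x = gradient \<phi> x" "laplacian f x = laplacian \<phi> x" "f x = \<phi> x"
      using gradient_cong[of ?U x f \<phi>] laplacian_cong[of ?U x f \<phi>] by blast+
    then show ?thesis using \<phi>(4,5) CM False \<kappa> by auto
  next
    case True
    \<comment> \<open>The boundary layer: the decay of \<open>\<phi>\<close> absorbs one derivative of \<open>\<theta>\<close>.\<close>
    have small: "\<bar>\<phi> x\<bar> \<le> M * \<epsilon>"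
      using \<phi>(3) mult_left_mono[OF True M0] by linarith
    have e1: "1 \<le> 1 / \<epsilon>" using \<epsilon> by simp
    have "norm (gradient f x) \<le> \<bar>\<phi> x\<bar> * norm (gradient \<theta> x) + \<bar>\<theta> x\<bar> * norm (gradient \<phi> x)"
      unfolding f_def gradient_mult[OF diff] by (rule order_trans[OF norm_triangle_ineq]) simp
    also have "\<dots> \<le> (M * \<epsilon>) * (C / \<epsilon>) + C * M"
      using small \<theta>(3,4) \<phi>(4) M0 C0 \<epsilon> by (intro add_mono mult_mono) auto
    also have "\<dots> = 2 * (C * M)" using \<epsilon> by simp
    finally have g: "norm (gradient f x) \<le> 2 * (C * M)" .
    have "\<bar>laplacian f x\<bar> \<le> \<bar>\<phi> x * laplacian \<theta> x\<bar> + \<bar>2 * (gradient \<phi> x \<bullet> gradient \<theta> x)\<bar> + \<bar>\<theta> x * laplacian \<phi> x\<bar>"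
      unfolding f_def laplacian_mult[OF \<Omega> x \<phi>(1) \<theta>\<Omega>] by linarith
    also have "\<dots> \<le> (M * \<epsilon>) * (C / \<epsilon>\<^sup>2) + 2 * (M * (C / \<epsilon>)) + C * M"
    proof (intro add_mono)
      show "\<bar>\<phi> x * laplacian \<theta> x\<bar> \<le> (M * \<epsilon>) * (C / \<epsilon>\<^sup>2)"
        unfolding abs_mult using small \<theta>(5) M0 \<epsilon> by (intro mult_mono) auto
      have "\<bar>gradient \<phi> x \<bullet> gradient \<theta> x\<bar> \<le> norm (gradient \<phi> x) * norm (gradient \<theta> x)"
        by (rule Cauchy_Schwarz_ineq2)
      also have "\<dots> \<le> M * (C / \<epsilon>)" using \<phi>(4) \<theta>(4) M0 by (intro mult_mono) auto
      finally show "\<bar>2 * (gradient \<phi> x \<bullet> gradient \<theta> x)\<bar> \<le> 2 * (M * (C / \<epsilon>))" by simp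
      show "\<bar>\<theta> x * laplacian \<phi> x\<bar> \<le> C * M"
        unfolding abs_mult using \<theta>(3) \<phi>(5) C0 by (intro mult_mono) auto
    qed
    also have "\<dots> = 3 * (C * M) * (1 / \<epsilon>) + C * M"
      using \<epsilon> by (simp add: power2_eq_square field_simps)
    also have "\<dots> \<le> 3 * (C * M) * (1 / \<epsilon>) + (C * M) * (1 / \<epsilon>)"
      using mult_left_mono[OF e1 CM(1)] by simp
    finally have l: "\<bar>laplacian f x\<bar> \<le> 4 * (C * M) * (1 / \<epsilon>)" by simp
    have "\<bar>laplacian f x - laplacian \<phi> x\<bar> \<le> 4 * (C * M) * (1 / \<epsilon>) + M * (1 / \<epsilon>)"
      using l \<phi>(5) mult_left_mono[OF e1 M0] by linarith
    then have "\<bar>laplacian f x - laplacian \<phi> x\<bar> \<le> B * (1 / \<epsilon>)"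
      by (simp add: B_def distrib_right add_divide_distrib)
    moreover have "\<bar>laplacian f x\<bar> \<le> B * (1 / \<epsilon>) + B"
      using calculation \<phi>(5) CM(3) by linarith
    moreover have "norm (gradient f x - gradient \<phi> x) \<le> B"
      using norm_triangle_ineq4[of "gradient f x" "gradient \<phi> x"] g \<phi>(4) CM(1) by (simp add: B_def)
    moreover have "\<bar>f x - \<phi> x\<bar> \<le> B" using f_abs \<phi>(2) CM(4) by linarith
    moreover have "norm (gradient f x) \<le> B" using g CM(1) M0 by (simp add: B_def)
    ultimately show ?thesis using True \<kappa> by simp
  qed
  have B0: "0 \<le> B" using CM by linarith
  have AB: "A = 2 * B" by (simp add: A B_def)
  have \<kappa>e: "0 \<le> \<kappa>" "0 \<le> \<kappa> / \<epsilon>" "\<kappa> \<le> \<kappa> / \<epsilon>" using \<kappa> \<epsilon> by (auto simp: field_simps)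
  have uf: "u = (\<lambda>x. f x * (1 - \<psi> x))" by (simp add: u f_def)
  have w: "Ck_on 2 \<Omega> (\<lambda>x. 1 - \<psi> x)"
    by (rule Ck_on_subset[OF derivatives_one_minus(1)[OF \<psi>(1)]]) simp
  have diff_fw: "f differentiable (at x)" "(\<lambda>x. 1 - \<psi> x) differentiable (at x)"
    using f2 w x by (simp_all add: Ck_on_2_iff)
  have \<psi>mono: "y * \<psi> x \<le> z * \<psi> x" if "y \<le> z" for y z
    using that \<psi>(2) by (rule mult_right_mono)
  have Bmono: "B * y \<le> B * z" if "y \<le> z" for y z using that B0 by (rule mult_left_mono)
  define p q where "p = norm (gradient \<psi> x)" and "q = \<bar>laplacian \<psi> x\<bar>"
  have pq: "0 \<le> B * p" "0 \<le> B * q" "0 \<le> B * \<psi> x" "0 \<le> B * (\<kappa> / \<epsilon>)" "0 \<le> B * \<kappa>"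
    using B0 \<psi>(2) by (auto intro!: mult_nonneg_nonneg \<kappa>e simp: p_def q_def simp del: times_divide_eq_right)
  have pq6: "B * \<kappa> \<le> B * (\<kappa> / \<epsilon>)" by (rule Bmono[OF \<kappa>e(3)])
  have fp: "\<bar>f x\<bar> * p \<le> B * p" "\<bar>f x\<bar> * q \<le> B * q" "\<bar>f x\<bar> * \<psi> x \<le> B * \<psi> x"
    using f_abs CM(2) \<psi>(2) by (auto simp: p_def q_def intro!: mult_right_mono)
  have "u x - \<phi> x = (f x - \<phi> x) - f x * \<psi> x" by (simp add: uf algebra_simps)
  then have "\<bar>u x - \<phi> x\<bar> \<le> \<bar>f x - \<phi> x\<bar> + \<bar>f x\<bar> * \<psi> x"
    using abs_triangle_ineq4[of "f x - \<phi> x" "f x * \<psi> x"] \<psi>(2) by (simp add: abs_mult)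
  also have "\<dots> \<le> A * (\<kappa> + \<psi> x)"
    unfolding AB using conjunct1[OF f] fp(3) pq by (simp add: algebra_simps)
  finally show "\<bar>u x - \<phi> x\<bar> \<le> A * (\<kappa> + \<psi> x)" .
  have gu: "gradient u x - gradient \<phi> x
      = (gradient f x - gradient \<phi> x) - (f x *\<^sub>R gradient \<psi> x + \<psi> x *\<^sub>R gradient f x)"
    unfolding uf gradient_mult[OF diff_fw] derivatives_one_minus(2)[OF \<psi>(1)] by (simp add: algebra_simps)
  have "norm (gradient u x - gradient \<phi> x) \<le> norm (gradient f x - gradient \<phi> x)
      + (norm (f x *\<^sub>R gradient \<psi> x) + norm (\<psi> x *\<^sub>R gradient f x))"
    unfolding gu
    using norm_triangle_ineq4[of "gradient f x - gradient \<phi> x" "f x *\<^sub>R gradient \<psi> x + \<psi> x *\<^sub>R gradient f x"]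
      norm_triangle_ineq[of "f x *\<^sub>R gradient \<psi> x" "\<psi> x *\<^sub>R gradient f x"] by linarith
  also have "\<dots> \<le> B * (\<kappa> / \<epsilon>) + (B * p + B * \<psi> x)"
  proof (intro add_mono)
    show "norm (gradient f x - gradient \<phi> x) \<le> B * (\<kappa> / \<epsilon>)" using f pq6 by linarith
    show "norm (f x *\<^sub>R gradient \<psi> x) \<le> B * p" using fp(1) by (simp add: p_def)
    show "norm (\<psi> x *\<^sub>R gradient f x) \<le> B * \<psi> x"
      using \<psi>mono[of "norm (gradient f x)" B] f \<psi>(2) by (simp add: mult.commute)
  qed
  also have "\<dots> \<le> A * (\<kappa> / \<epsilon> + \<psi> x + p + q)"
    unfolding AB distrib_left mult.assoc using pq by linarith
  finally show "norm (gradient u x - gradient \<phi> x)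
      \<le> A * (\<kappa> / \<epsilon> + \<psi> x + norm (gradient \<psi> x) + \<bar>laplacian \<psi> x\<bar>)"
    by (simp only: p_def q_def)
  have "laplacian u x - laplacian \<phi> x = (laplacian f x - laplacian \<phi> x)
      - f x * laplacian \<psi> x - 2 * (gradient f x \<bullet> gradient \<psi> x) - laplacian f x * \<psi> x"
    unfolding uf laplacian_mult[OF \<Omega> x f2 w] derivatives_one_minus(2,3)[OF \<psi>(1)]
    by (simp add: algebra_simps)
  then have "\<bar>laplacian u x - laplacian \<phi> x\<bar> \<le> \<bar>laplacian f x - laplacian \<phi> x\<bar>
      + \<bar>f x * laplacian \<psi> x\<bar> + 2 * \<bar>gradient f x \<bullet> gradient \<psi> x\<bar> + \<bar>laplacian f x * \<psi> x\<bar>"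
    by linarith
  also have "\<dots> \<le> B * (\<kappa> / \<epsilon>) + B * q + 2 * (B * p) + (B * (\<kappa> / \<epsilon>) + B * \<psi> x)"
  proof (intro add_mono mult_left_mono)
    show "\<bar>f x * laplacian \<psi> x\<bar> \<le> B * q" using fp(2) by (simp add: q_def abs_mult)
    have "\<bar>gradient f x \<bullet> gradient \<psi> x\<bar> \<le> norm (gradient f x) * p"
      unfolding p_def by (rule Cauchy_Schwarz_ineq2)
    also have "\<dots> \<le> B * p" using f by (intro mult_right_mono) (auto simp: p_def)
    finally show "\<bar>gradient f x \<bullet> gradient \<psi> x\<bar> \<le> B * p" .
    have "\<bar>laplacian f x * \<psi> x\<bar> \<le> (B * (\<kappa> / \<epsilon>) + B) * \<psi> x"
      using \<psi>mono[of "\<bar>laplacian f x\<bar>" "B * (\<kappa> / \<epsilon>) + B"] f \<psi>(2) by (simp add: abs_mult)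
    also have "\<dots> \<le> B * (\<kappa> / \<epsilon>) + B * \<psi> x"
      using mult_left_le[OF \<psi>(3) pq(4)] by (simp add: distrib_right)
    finally show "\<bar>laplacian f x * \<psi> x\<bar> \<le> B * (\<kappa> / \<epsilon>) + B * \<psi> x" .
  qed (use f in auto)
  also have "\<dots> \<le> A * (\<kappa> / \<epsilon> + \<psi> x + p + q)"
    unfolding AB distrib_left mult.assoc using pq by linarith
  finally show "\<bar>laplacian u x - laplacian \<phi> x\<bar>
      \<le> A * (\<kappa> / \<epsilon> + \<psi> x + norm (gradient \<psi> x) + \<bar>laplacian \<psi> x\<bar>)"
    by (simp only: p_def q_def)
qed

section \<open>Consequences of small norm and of the boundary condition on test functions\<close>

lemma enn_sqrt_le: "enn_sqrt v \<le> 1 + v"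
proof (cases v)
  case (real r)
  have "sqrt r \<le> 1 + r"
    by (rule real_le_lsqrt) (use real in \<open>auto simp: power2_eq_square algebra_simps\<close>)
  then show ?thesis using real by (simp add: enn_sqrt_def ennreal_plus[symmetric] ennreal_1[symmetric] del: ennreal_1 ennreal_plus)
qed simp

lemma ennreal_le_mult_of_divide_le:
  fixes p w :: ennreal
  assumes "p / w \<le> a" "0 < a" "a < top" "p \<noteq> top"
  shows "p \<le> a * w"
proof (cases "w = top")
  case True
  then show ?thesis using assms(2) by (simp add: ennreal_mult_top)
next
  case fin: False
  show ?thesis
  proof (cases "w = 0")
    case True
    then show ?thesis using assms(1,3) by (auto split: if_splits simp: top_unique)
  next
    case False
    have "p = p / w * w"
      using False fin by (simp add: ennreal_divide_times ennreal_divide_self top.not_eq_extremum)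
    also have "\<dots> \<le> a * w" using assms(1) by (rule mult_right_mono) simp
    finally show ?thesis .
  qed
qed

text \<open>The bound \<open>1 + V\<close> dominates both \<open>V\<close> and its square root, so that a function \<open>g\<close> which is integrable
  and lies in \<open>L1_V\<close> can serve as a weight for either derivative. Where \<open>V\<close> is infinite the
  right-hand sides are infinite because \<open>a\<close> is positive.\<close>

lemma norm_V_inf_AE:
  assumes "norm_V_inf \<Omega> V \<psi> \<le> a" "0 < a" "a < top"
  shows "AE x in lebesgue_on \<Omega>. ennreal (norm (gradient \<psi> x)) \<le> a * (1 + V x)"
    and "AE x in lebesgue_on \<Omega>. ennreal \<bar>laplacian \<psi> x\<bar> \<le> a * (1 + V x)"
    and "(\<integral>\<^sup>+ x. ennreal \<bar>\<psi> x\<bar> \<partial>lebesgue_on \<Omega>) \<le> a"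
proof -
  have s: "s \<le> a \<and> t \<le> a \<and> r \<le> a" if "r + s + t \<le> a" for r s t :: ennreal
  proof -
    have "r \<le> r + s + t" "s \<le> r + s + t" "t \<le> r + s + t"
      by (simp_all add: add_increasing add_increasing2)
    then show ?thesis using that by (blast intro: order_trans)
  qed
  let ?s = "esssup (lebesgue_on \<Omega>) (\<lambda>x. ennreal (norm (gradient \<psi> x)) / enn_sqrt (V x))"
  let ?t = "esssup (lebesgue_on \<Omega>) (\<lambda>x. ennreal \<bar>laplacian \<psi> x\<bar> / V x)"
  have st: "?s \<le> a \<and> ?t \<le> a \<and> (\<integral>\<^sup>+ x. ennreal \<bar>\<psi> x\<bar> \<partial>lebesgue_on \<Omega>) \<le> a"
    by (rule s) (use assms(1) in \<open>simp add: norm_V_inf_def\<close>)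
  then show "(\<integral>\<^sup>+ x. ennreal \<bar>\<psi> x\<bar> \<partial>lebesgue_on \<Omega>) \<le> a" by blast
  have "AE x in lebesgue_on \<Omega>. ennreal (norm (gradient \<psi> x)) / enn_sqrt (V x) \<le> ?s"
    by (rule esssup_AE)
  then show "AE x in lebesgue_on \<Omega>. ennreal (norm (gradient \<psi> x)) \<le> a * (1 + V x)"
  proof eventually_elim
    case (elim x)
    then have "ennreal (norm (gradient \<psi> x)) \<le> a * enn_sqrt (V x)"
      using st assms(2,3) by (intro ennreal_le_mult_of_divide_le) auto
    also have "\<dots> \<le> a * (1 + V x)" by (intro mult_left_mono enn_sqrt_le) simp
    finally show ?case .
  qed
  have "AE x in lebesgue_on \<Omega>. ennreal \<bar>laplacian \<psi> x\<bar> / V x \<le> ?t"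
    by (rule esssup_AE)
  then show "AE x in lebesgue_on \<Omega>. ennreal \<bar>laplacian \<psi> x\<bar> \<le> a * (1 + V x)"
  proof eventually_elim
    case (elim x)
    then have "ennreal \<bar>laplacian \<psi> x\<bar> \<le> a * V x"
      using st assms(2,3) by (intro ennreal_le_mult_of_divide_le) auto
    also have "\<dots> \<le> a * (1 + V x)" by (intro mult_left_mono) auto
    finally show ?case .
  qed
qed

text \<open>Dominated convergence; \<open>G\<close> may be infinite on a null set only, and elsewhere multiplication by
  its value is continuous.\<close>

lemma tendsto_nn_integral_vanishing_factor:
  fixes s :: "nat \<Rightarrow> 'a \<Rightarrow> real"
  assumes [measurable]: "G \<in> borel_measurable M" "\<And>j. s j \<in> borel_measurable M"
    and fin: "(\<integral>\<^sup>+ x. G x \<partial>M) < top"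
    and B: "\<And>j x. x \<in> space M \<Longrightarrow> s j x \<le> B"
    and lim: "AE x in M. (\<lambda>j. s j x) \<longlonglongrightarrow> 0"
  shows "(\<lambda>j. \<integral>\<^sup>+ x. ennreal (s j x) * G x \<partial>M) \<longlonglongrightarrow> 0"
proof -
  have "(\<lambda>j. \<integral>\<^sup>+ x. ennreal (s j x) * G x \<partial>M) \<longlonglongrightarrow> (\<integral>\<^sup>+ x. 0 \<partial>M)"
  proof (rule nn_integral_dominated_convergence[where w = "\<lambda>x. ennreal B * G x"])
    show "AE x in M. ennreal (s j x) * G x \<le> ennreal B * G x" for j
      by (intro AE_I2 mult_right_mono ennreal_leI B) auto
    show "(\<integral>\<^sup>+ x. ennreal B * G x \<partial>M) < \<infinity>"
      using fin by (simp add: nn_integral_cmult ennreal_mult_less_top)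
    have "AE x in M. G x \<noteq> \<infinity>"
      using fin by (intro nn_integral_PInf_AE) (auto simp: less_top)
    with lim show "AE x in M. (\<lambda>j. ennreal (s j x) * G x) \<longlonglongrightarrow> 0"
    proof eventually_elim
      case (elim x)
      have "(\<lambda>j. G x * ennreal (s j x)) \<longlonglongrightarrow> G x * ennreal 0"
        using elim by (intro ennreal_tendsto_cmult tendsto_ennrealI) (auto simp: top.not_eq_extremum)
      then show ?case by (simp add: mult.commute)
    qed
  qed auto
  then show ?thesis by simp
qed

text \<open>The condition defining \<open>L1_0\<close>, rewritten as a nonnegative integral over all of \<open>\<Omega>\<close> along a sequence
  of widths.\<close>

lemma L1_0_boundary_layer:
  fixes \<Omega> :: "'a::euclidean_space set"
  assumes \<Omega>: "open \<Omega>" and g: "g \<in> L1_0 \<Omega>" and e: "\<And>j. 0 < e j" "e \<longlonglongrightarrow> 0"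
  shows "(\<lambda>j. \<integral>\<^sup>+ x. ennreal (\<bar>g x\<bar> * ((if infdist x (frontier \<Omega>) \<le> e j then 1 else 0) / e j))
    \<partial>lebesgue_on \<Omega>) \<longlonglongrightarrow> 0"
proof -
  let ?M = "lebesgue_on \<Omega>"
  let ?T = "\<lambda>\<epsilon>. {x. infdist x (frontier \<Omega>) \<le> \<epsilon>}"
  have int: "integrable ?M (\<lambda>x. \<bar>g x\<bar>)" using g by (simp add: L1_0_def)
  have closed: "closed (?T \<epsilon>)" for \<epsilon>
    by (intro closed_Collect_le continuous_intros)
  then have T: "?T \<epsilon> \<in> sets lebesgue" for \<epsilon>
    by (intro sets_completionI_sets) auto
  have \<Omega>s: "\<Omega> \<in> sets lebesgue" using \<Omega> by (intro sets_completionI_sets) auto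
  have TM: "?T \<epsilon> \<inter> space ?M \<in> sets ?M" for \<epsilon>
    using T[of \<epsilon>] \<Omega>s by (auto simp: sets_restrict_space_iff)
  have r: "restrict_space ?M (?T \<epsilon>) = lebesgue_on {x\<in>\<Omega>. infdist x (frontier \<Omega>) \<le> \<epsilon>}" for \<epsilon>
    using \<Omega>s by (subst restrict_restrict_space) (auto intro!: arg_cong[where f = lebesgue_on] T)
  have eq: "(\<integral>\<^sup>+ x. ennreal (\<bar>g x\<bar> * ((if infdist x (frontier \<Omega>) \<le> \<epsilon> then 1 else 0) / \<epsilon>)) \<partial>?M)
      = ennreal (1 / \<epsilon> * (LINT x | lebesgue_on {x\<in>\<Omega>. infdist x (frontier \<Omega>) \<le> \<epsilon>}. \<bar>g x\<bar>))"
    if "0 < \<epsilon>" for \<epsilon> :: real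
  proof -
    have int': "integrable (restrict_space ?M (?T \<epsilon>)) (\<lambda>x. \<bar>g x\<bar>)"
    proof -
      have "integrable ?M (\<lambda>x. indicator (?T \<epsilon> \<inter> space ?M) x *\<^sub>R \<bar>g x\<bar>)"
        by (rule integrable_mult_indicator[OF TM int])
      moreover have "integrable ?M (\<lambda>x. indicator (?T \<epsilon> \<inter> space ?M) x *\<^sub>R \<bar>g x\<bar>)
          \<longleftrightarrow> integrable ?M (\<lambda>x. indicator (?T \<epsilon>) x *\<^sub>R \<bar>g x\<bar>)"
        by (intro Bochner_Integration.integrable_cong refl) (auto split: split_indicator)
      ultimately show ?thesis by (simp only: integrable_restrict_space[OF TM])
    qed
    have "(\<integral>\<^sup>+ x. ennreal (\<bar>g x\<bar> * ((if infdist x (frontier \<Omega>) \<le> \<epsilon> then 1 else 0) / \<epsilon>)) \<partial>?M)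
      = (\<integral>\<^sup>+ x. ennreal (1 / \<epsilon> * \<bar>g x\<bar>) * indicator (?T \<epsilon>) x \<partial>?M)"
      by (intro nn_integral_cong) (auto split: split_indicator)
    also have "\<dots> = (\<integral>\<^sup>+ x. ennreal (1 / \<epsilon> * \<bar>g x\<bar>) \<partial>restrict_space ?M (?T \<epsilon>))"
      by (rule nn_integral_restrict_space[OF TM, symmetric])
    also have "\<dots> = ennreal (LINT x | restrict_space ?M (?T \<epsilon>). 1 / \<epsilon> * \<bar>g x\<bar>)"
      using int' that by (intro nn_integral_eq_integral integrable_mult_right) auto
    finally show ?thesis unfolding r by simp
  qed
  have lim: "(\<lambda>j. 1 / e j * (LINT x | lebesgue_on {x\<in>\<Omega>. infdist x (frontier \<Omega>) \<le> e j}. \<bar>g x\<bar>)) \<longlonglongrightarrow> 0"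
  proof -
    have "filterlim e (at_right 0) sequentially"
    proof -
      have "e j \<noteq> 0" for j using e(1)[of j] by simp
      then show ?thesis unfolding filterlim_at using e by simp
    qed
    moreover have "((\<lambda>\<epsilon>. 1 / \<epsilon> * (LINT x | lebesgue_on {x\<in>\<Omega>. infdist x (frontier \<Omega>) \<le> \<epsilon>}. \<bar>g x\<bar>))
        \<longlongrightarrow> 0) (at_right 0)"
      using g by (simp add: L1_0_def)
    ultimately show ?thesis by (rule filterlim_compose[rotated])
  qed
  show ?thesis
    unfolding eq[OF e(1)] using tendsto_ennrealI[OF lim] by (simp only: ennreal_0)
qed

section \<open>Convergence of the weighted error integrals\<close>

lemma borel_measurable_lebesgue_on_of_continuous:
  fixes f :: "'a::euclidean_space \<Rightarrow> 'b::topological_space"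
  assumes "open \<Omega>" "continuous_on UNIV f"
  shows "f \<in> borel_measurable (lebesgue_on \<Omega>)"
  using assms continuous_on_subset[OF assms(2)]
  by (intro continuous_imp_measurable_on_sets_lebesgue) (auto intro: sets_completionI_sets)

text \<open>Functions of small norm exist because the capacity is an infimum. Their integrals tend to 0, so a
  subsequence converges to 0 almost everywhere; along it the norm bounds only improve.\<close>

lemma zero_capacity_sequence:
  fixes \<Omega> :: "'a::euclidean_space set"
  assumes \<Omega>: "open \<Omega>" and cap: "Cap_V_inf \<Omega> V K = 0"
  shows "\<exists>\<psi> :: nat \<Rightarrow> 'a \<Rightarrow> real.
    (\<forall>j. \<psi> j \<in> B2 \<Omega> K \<and> norm_V_inf \<Omega> V (\<psi> j) \<le> ennreal (inverse (real (Suc j)))) \<and>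
    (AE x in lebesgue_on \<Omega>. (\<lambda>j. \<psi> j x) \<longlonglongrightarrow> 0)"
proof -
  let ?M = "lebesgue_on \<Omega>"
  let ?\<epsilon> = "\<lambda>j. inverse (real (Suc j))"
  have "\<exists>\<psi>\<in>B2 \<Omega> K. norm_V_inf \<Omega> V \<psi> < ennreal (?\<epsilon> j)" for j
    using cap unfolding Cap_V_inf_def INF_less_iff[symmetric] by simp
  then obtain \<psi> where \<psi>: "\<And>j. \<psi> j \<in> B2 \<Omega> K" "\<And>j. norm_V_inf \<Omega> V (\<psi> j) < ennreal (?\<epsilon> j)"
    by metis
  have C: "Ck_on 2 UNIV (\<psi> j)" for j
    using Ck_on_UNIV_of_C2_c[OF \<Omega>, of "\<psi> j"] \<psi>(1)[of j] by (simp add: B2_def)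
  have [measurable]: "\<psi> j \<in> borel_measurable ?M" for j
    by (intro borel_measurable_lebesgue_on_of_continuous \<Omega> Ck_on_2_continuous(1)[OF C])
  have le: "(\<integral>\<^sup>+ x. ennreal \<bar>\<psi> j x\<bar> \<partial>?M) \<le> ennreal (?\<epsilon> j)" for j
    by (rule norm_V_inf_AE(3)[of _ V]) (use \<psi>(2)[of j] in auto)
  have int: "integrable ?M (\<psi> j)" for j
    by (rule integrableI_bounded) (use order.strict_trans1[OF le[of j] ennreal_less_top] in auto)
  have "(\<integral>x. norm (\<psi> j x) \<partial>?M) \<le> ?\<epsilon> j" for j
    by (subst integral_eq_nn_integral) (use le[of j] in \<open>auto intro!: enn2real_leI\<close>)
  then have "(\<lambda>j. \<integral>x. norm (\<psi> j x) \<partial>?M) \<longlonglongrightarrow> 0"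
    by (intro tendsto_sandwich[OF _ _ tendsto_const LIMSEQ_inverse_real_of_nat])
      (auto intro!: always_eventually)
  from tendsto_L1_AE_subseq[OF int this]
  obtain r where r: "strict_mono r" "AE x in ?M. (\<lambda>j. \<psi> (r j) x) \<longlonglongrightarrow> 0" by blast
  have "norm_V_inf \<Omega> V (\<psi> (r j)) \<le> ennreal (?\<epsilon> j)" for j
  proof -
    have "?\<epsilon> (r j) \<le> ?\<epsilon> j" using seq_suble[OF r(1), of j] by (intro le_imp_inverse_le) auto
    then show ?thesis using \<psi>(2)[of "r j"] by (meson ennreal_leI less_imp_le order_trans)
  qed
  then show ?thesis using \<psi>(1) r(2) by (intro exI[of _ "\<lambda>j. \<psi> (r j)"]) blast
qed

text \<open>The integrals over \<open>\<Omega>\<close> of the error terms of \<open>cutoff_product_estimates\<close>, weighted by \<open>\<bar>g\<bar>\<close>. The boundary layer term is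
  controlled by \<open>L1_0\<close>, the terms with \<open>\<psi> j\<close> itself by dominated convergence, and the derivatives
  of \<open>\<psi> j\<close> are at most \<open>e j * (1 + V)\<close>, which is integrable against \<open>\<bar>g\<bar>\<close>.\<close>

lemma weighted_errors_tendsto_0:
  fixes \<Omega> :: "'a::euclidean_space set"
  assumes \<Omega>: "open \<Omega>" and V: "V \<in> borel_measurable (lebesgue_on \<Omega>)"
    and g: "g \<in> L1_V \<Omega> V" "g \<in> L1_0 \<Omega>"
    and \<psi>: "\<And>j. Ck_on 2 UNIV (\<psi> j)" "\<And>j x. 0 \<le> \<psi> j x" "\<And>j x. \<psi> j x \<le> 1"
    and e: "\<And>j. 0 < e j" "e \<longlonglongrightarrow> 0"
    and norm: "\<And>j. norm_V_inf \<Omega> V (\<psi> j) \<le> ennreal (e j)"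
    and AE: "AE x in lebesgue_on \<Omega>. (\<lambda>j. \<psi> j x) \<longlonglongrightarrow> 0"
    and frontier: "frontier \<Omega> \<noteq> {}"
    and \<kappa>: "\<kappa> = (\<lambda>j x. if infdist x (frontier \<Omega>) \<le> e j then 1 else 0)"
  shows "(\<lambda>j. \<integral>\<^sup>+ x. ennreal (\<kappa> j x + \<psi> j x) * (ennreal \<bar>g x\<bar> * V x) \<partial>lebesgue_on \<Omega>) \<longlonglongrightarrow> 0"
    and "(\<lambda>j. \<integral>\<^sup>+ x. ennreal (\<bar>g x\<bar> *
      (\<kappa> j x / e j + \<psi> j x + norm (gradient (\<psi> j) x) + \<bar>laplacian (\<psi> j) x\<bar>)) \<partial>lebesgue_on \<Omega>) \<longlonglongrightarrow> 0"
proof -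
  let ?M = "lebesgue_on \<Omega>"
  note V[measurable]
  have [measurable]: "g \<in> borel_measurable ?M" using g(1) by (simp add: L1_V_def)
  have gV: "(\<integral>\<^sup>+ x. ennreal \<bar>g x\<bar> * V x \<partial>?M) < top" using g(1) by (simp add: L1_V_def)
  have g1: "(\<integral>\<^sup>+ x. ennreal \<bar>g x\<bar> \<partial>?M) < top"
    using g(2) by (simp add: L1_0_def integrable_iff_bounded)
  note meas = borel_measurable_lebesgue_on_of_continuous[OF \<Omega>]
  have [measurable]: "\<psi> j \<in> borel_measurable ?M" "gradient (\<psi> j) \<in> borel_measurable ?M"
    "laplacian (\<psi> j) \<in> borel_measurable ?M" for j
    using Ck_on_2_continuous[OF \<psi>(1)] by (auto intro: meas)
  have [measurable]: "(\<lambda>x. infdist x (frontier \<Omega>)) \<in> borel_measurable ?M"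
    by (intro meas continuous_intros)
  have [measurable]: "\<kappa> j \<in> borel_measurable ?M" for j unfolding \<kappa> by measurable
  have \<kappa>01: "0 \<le> \<kappa> j x" "\<kappa> j x \<le> 1" for j x by (auto simp: \<kappa>)
  have \<kappa>0: "(\<lambda>j. \<kappa> j x) \<longlonglongrightarrow> 0" if "x \<in> \<Omega>" for x
  proof -
    have "x \<notin> frontier \<Omega>" using that \<Omega> by (simp add: frontier_def interior_open)
    then have "0 < infdist x (frontier \<Omega>)"
      using infdist_pos_not_in_closed[OF frontier_closed frontier] by blast
    then have "eventually (\<lambda>j. e j < infdist x (frontier \<Omega>)) sequentially"
      by (rule order_tendstoD(2)[OF e(2)])
    then have "eventually (\<lambda>j. \<kappa> j x = 0) sequentially"
      by eventually_elim (simp add: \<kappa>)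
    then show ?thesis by (rule tendsto_eventually)
  qed
  show "(\<lambda>j. \<integral>\<^sup>+ x. ennreal (\<kappa> j x + \<psi> j x) * (ennreal \<bar>g x\<bar> * V x) \<partial>?M) \<longlonglongrightarrow> 0"
  proof (rule tendsto_nn_integral_vanishing_factor[OF _ _ gV])
    show "\<kappa> j x + \<psi> j x \<le> 2" for j x using \<kappa>01(2)[of j x] \<psi>(3)[of j x] by linarith
    have "AE x in ?M. x \<in> \<Omega>" by (rule AE_I2) simp
    with AE show "AE x in ?M. (\<lambda>j. \<kappa> j x + \<psi> j x) \<longlonglongrightarrow> 0"
    proof eventually_elim
      case (elim x)
      then show ?case using tendsto_add[OF \<kappa>0[of x] elim(1)] by simp
    qed
  qed auto
  define J where "J = (\<integral>\<^sup>+ x. ennreal \<bar>g x\<bar> * (1 + V x) \<partial>?M)"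
  have "J = (\<integral>\<^sup>+ x. ennreal \<bar>g x\<bar> \<partial>?M) + (\<integral>\<^sup>+ x. ennreal \<bar>g x\<bar> * V x \<partial>?M)"
    unfolding J_def by (subst nn_integral_add[symmetric]) (auto simp: distrib_left)
  then have J: "J < top" using gV g1 by simp
  have dominated: "(\<integral>\<^sup>+ x. ennreal \<bar>g x\<bar> * ennreal (p x) \<partial>?M) \<le> ennreal (e j) * J"
    if "AE x in ?M. ennreal (p x) \<le> ennreal (e j) * (1 + V x)" for p j
  proof -
    have "(\<integral>\<^sup>+ x. ennreal \<bar>g x\<bar> * ennreal (p x) \<partial>?M)
        \<le> (\<integral>\<^sup>+ x. ennreal (e j) * (ennreal \<bar>g x\<bar> * (1 + V x)) \<partial>?M)"
    proof (rule nn_integral_mono_AE)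
      show "AE x in ?M. ennreal \<bar>g x\<bar> * ennreal (p x) \<le> ennreal (e j) * (ennreal \<bar>g x\<bar> * (1 + V x))"
        using that
        by eventually_elim (subst mult.left_commute, rule mult_left_mono, auto)
    qed
    also have "\<dots> = ennreal (e j) * J" unfolding J_def by (rule nn_integral_cmult) measurable
    finally show ?thesis .
  qed
  let ?I1 = "\<lambda>j. \<integral>\<^sup>+ x. ennreal (\<bar>g x\<bar> * (\<kappa> j x / e j)) \<partial>?M"
  let ?I2 = "\<lambda>j. \<integral>\<^sup>+ x. ennreal (\<psi> j x) * ennreal \<bar>g x\<bar> \<partial>?M"
  have bd: "(\<integral>\<^sup>+ x. ennreal (\<bar>g x\<bar> *
      (\<kappa> j x / e j + \<psi> j x + norm (gradient (\<psi> j) x) + \<bar>laplacian (\<psi> j) x\<bar>)) \<partial>?M)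
      \<le> ?I1 j + ?I2 j + ennreal (e j) * J + ennreal (e j) * J" for j
  proof -
    let ?t1 = "\<lambda>x. ennreal (\<bar>g x\<bar> * (\<kappa> j x / e j))"
    let ?t2 = "\<lambda>x. ennreal (\<psi> j x) * ennreal \<bar>g x\<bar>"
    let ?t3 = "\<lambda>x. ennreal \<bar>g x\<bar> * ennreal (norm (gradient (\<psi> j) x))"
    let ?t4 = "\<lambda>x. ennreal \<bar>g x\<bar> * ennreal \<bar>laplacian (\<psi> j) x\<bar>"
    have "ennreal (\<bar>g x\<bar> *
      (\<kappa> j x / e j + \<psi> j x + norm (gradient (\<psi> j) x) + \<bar>laplacian (\<psi> j) x\<bar>))
      = ?t1 x + ?t2 x + ?t3 x + ?t4 x" for x
      using \<kappa>01(1)[of j x] \<psi>(2)[of j x] less_imp_le[OF e(1)[of j]]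
      by (simp add: distrib_left ennreal_mult[symmetric] ennreal_plus[symmetric] mult.commute
          del: ennreal_plus)
    then have "(\<integral>\<^sup>+ x. ennreal (\<bar>g x\<bar> *
      (\<kappa> j x / e j + \<psi> j x + norm (gradient (\<psi> j) x) + \<bar>laplacian (\<psi> j) x\<bar>)) \<partial>?M)
      = (\<integral>\<^sup>+ x. ?t1 x + ?t2 x + ?t3 x + ?t4 x \<partial>?M)" by simp
    also have "\<dots> = ?I1 j + ?I2 j + (\<integral>\<^sup>+ x. ?t3 x \<partial>?M) + (\<integral>\<^sup>+ x. ?t4 x \<partial>?M)"
      by (simp add: nn_integral_add)
    also have "\<dots> \<le> ?I1 j + ?I2 j + ennreal (e j) * J + ennreal (e j) * J"
      using norm_V_inf_AE(1,2)[OF norm[of j]] e(1)[of j]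
      by (intro add_mono order_refl dominated) auto
    finally show ?thesis .
  qed
  have lim: "(\<lambda>j. ?I1 j + ?I2 j + ennreal (e j) * J + ennreal (e j) * J) \<longlonglongrightarrow> 0 + 0 + 0 + 0"
  proof (intro tendsto_add)
    show "?I1 \<longlonglongrightarrow> 0" using L1_0_boundary_layer[OF \<Omega> g(2) e] by (simp add: \<kappa>)
    show "?I2 \<longlonglongrightarrow> 0"
      by (rule tendsto_nn_integral_vanishing_factor[OF _ _ g1 \<psi>(3) AE]) auto
    have "(\<lambda>j. J * ennreal (e j)) \<longlonglongrightarrow> J * ennreal 0"
      by (intro ennreal_tendsto_cmult J tendsto_ennrealI e)
    then show "(\<lambda>j. ennreal (e j) * J) \<longlonglongrightarrow> 0" "(\<lambda>j. ennreal (e j) * J) \<longlonglongrightarrow> 0"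
      by (simp_all add: mult.commute)
  qed
  show "(\<lambda>j. \<integral>\<^sup>+ x. ennreal (\<bar>g x\<bar> *
      (\<kappa> j x / e j + \<psi> j x + norm (gradient (\<psi> j) x) + \<bar>laplacian (\<psi> j) x\<bar>)) \<partial>?M) \<longlonglongrightarrow> 0"
    by (rule tendsto_sandwich[OF always_eventually always_eventually tendsto_const lim[unfolded add_0_right]])
      (rule allI, simp, rule allI, rule bd)
qed

section \<open>Density\<close>

lemma cutoff_product_in_C2_c:
  fixes \<Omega> :: "'a::euclidean_space set"
  assumes \<Omega>: "open \<Omega>" and K: "compact K" and \<phi>: "Ck_on 2 \<Omega> \<phi>"
    and \<theta>: "Ck_on 2 UNIV \<theta>" "compact (closure {x. \<theta> x \<noteq> 0})" "closure {x. \<theta> x \<noteq> 0} \<subseteq> \<Omega>"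
    and \<psi>: "\<psi> \<in> B2 \<Omega> K"
  shows "(\<lambda>x. \<phi> x * \<theta> x * (1 - \<psi> x)) \<in> C2_c (\<Omega> - K)"
proof -
  let ?u = "\<lambda>x. \<phi> x * \<theta> x * (1 - \<psi> x)" and ?S = "closure {x. \<theta> x \<noteq> 0}"
  obtain U where U: "open U" "K \<subseteq> U" "\<And>x. x \<in> U \<Longrightarrow> \<psi> x = 1"
    using \<psi> by (auto simp: B2_def)
  have "Ck_on 2 UNIV \<psi>" using Ck_on_UNIV_of_C2_c[OF \<Omega>] \<psi> by (simp add: B2_def)
  then have "Ck_on 2 \<Omega> (\<lambda>x. 1 - \<psi> x)" using Ck_on_subset[OF derivatives_one_minus(1)] by blast
  then have "Ck_on 2 \<Omega> ?u"
    by (intro Ck_on_mult \<Omega> \<phi>) (use Ck_on_subset[OF \<theta>(1)] in simp_all)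
  then have "Ck_on 2 (\<Omega> - K) ?u" by (rule Ck_on_subset) auto
  moreover have sub: "closure {x. ?u x \<noteq> 0} \<subseteq> ?S \<inter> - U"
  proof (rule closure_minimal)
    show "{x. ?u x \<noteq> 0} \<subseteq> ?S \<inter> - U" using U(3) closure_subset[of "{x. \<theta> x \<noteq> 0}"] by auto
    show "closed (?S \<inter> - U)" using U(1) by (intro closed_Int) auto
  qed
  moreover have "compact (closure {x. ?u x \<noteq> 0})"
    using bounded_subset[OF compact_imp_bounded[OF \<theta>(2)]] sub by (simp add: compact_eq_bounded_closed)
  ultimately show ?thesis using \<theta>(3) U(2) unfolding C2_c_def by blast
qed

text \<open>One index \<open>j\<close> governs both the width of the boundary layer and the norm of \<open>\<psi> j\<close>. No diagonal argument
  between the two limits is needed, because \<open>\<phi> \<theta> j\<close> and its gradient are bounded uniformly in \<open>j\<close> and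
  its Laplacian grows only inside the boundary layer.\<close>

lemma weakly_strongly_dense:
  fixes \<Omega> :: "'a::euclidean_space set"
  assumes \<Omega>: "open \<Omega>" "bounded \<Omega>" "\<Omega> \<noteq> {}" and K: "compact K"
    and V: "V \<in> borel_measurable (lebesgue_on \<Omega>)"
    and cap: "Cap_V_inf \<Omega> V K = 0" and \<phi>: "\<phi> \<in> C2_0 \<Omega>"
  shows "\<exists>\<phi>s. (\<forall>j. \<phi>s j \<in> C2_c (\<Omega> - K)) \<and> weakly_strongly_converges \<Omega> V \<phi>s \<phi>"
proof -
  let ?M = "lebesgue_on \<Omega>" and ?d = "\<lambda>x. infdist x (frontier \<Omega>)"
  define e where "e = (\<lambda>j. inverse (real (Suc j)))"
  have e: "\<And>j. 0 < e j" "\<And>j. e j \<le> 1" "e \<longlonglongrightarrow> 0"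
    unfolding e_def using LIMSEQ_inverse_real_of_nat by (auto simp: field_simps simp del: of_nat_Suc)
  have frontier: "frontier \<Omega> \<noteq> {}"
    using \<Omega> not_bounded_UNIV[where 'a = 'a] by (auto simp: frontier_eq_empty)
  have \<phi>2: "Ck_on 2 \<Omega> \<phi>" using \<phi> by (simp add: C2_0_def C2_closure_def)
  obtain M where M: "0 \<le> M" "\<And>x. x \<in> \<Omega> \<Longrightarrow> \<bar>\<phi> x\<bar> \<le> M" "\<And>x. x \<in> \<Omega> \<Longrightarrow> \<bar>\<phi> x\<bar> \<le> M * ?d x"
    "\<And>x. x \<in> \<Omega> \<Longrightarrow> norm (gradient \<phi> x) \<le> M" "\<And>x. x \<in> \<Omega> \<Longrightarrow> \<bar>laplacian \<phi> x\<bar> \<le> M"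
    using C2_0_bounds[OF \<Omega>(1,2) \<phi>] by blast
  obtain C where C0: "0 \<le> C" and C: "\<forall>\<epsilon>>0. \<exists>\<theta>. Ck_on 2 UNIV \<theta> \<and>
    compact (closure {x. \<theta> x \<noteq> 0}) \<and> closure {x. \<theta> x \<noteq> 0} \<subseteq> \<Omega> \<and>
    (\<forall>x\<in>\<Omega>. \<epsilon> < ?d x \<longrightarrow> \<theta> x = 1) \<and>
    (\<forall>x. \<bar>\<theta> x\<bar> \<le> C \<and> norm (gradient \<theta> x) \<le> C / \<epsilon> \<and> \<bar>laplacian \<theta> x\<bar> \<le> C / \<epsilon>\<^sup>2)"
    using boundary_cutoff[OF \<Omega>(2)] by blast
  have "\<forall>j. \<exists>\<theta>. Ck_on 2 UNIV \<theta> \<and>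
    compact (closure {x. \<theta> x \<noteq> 0}) \<and> closure {x. \<theta> x \<noteq> 0} \<subseteq> \<Omega> \<and>
    (\<forall>x\<in>\<Omega>. e j < ?d x \<longrightarrow> \<theta> x = 1) \<and>
    (\<forall>x. \<bar>\<theta> x\<bar> \<le> C \<and> norm (gradient \<theta> x) \<le> C / e j \<and> \<bar>laplacian \<theta> x\<bar> \<le> C / (e j)\<^sup>2)"
    using C e(1) by simp
  from choice[OF this] obtain \<theta> where \<theta>: "\<And>j. Ck_on 2 UNIV (\<theta> j)"
    "\<And>j. compact (closure {x. \<theta> j x \<noteq> 0})" "\<And>j. closure {x. \<theta> j x \<noteq> 0} \<subseteq> \<Omega>"
    "\<And>j x. x \<in> \<Omega> \<Longrightarrow> e j < ?d x \<Longrightarrow> \<theta> j x = 1"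
    "\<And>j x. \<bar>\<theta> j x\<bar> \<le> C" "\<And>j x. norm (gradient (\<theta> j) x) \<le> C / e j"
    "\<And>j x. \<bar>laplacian (\<theta> j) x\<bar> \<le> C / (e j)\<^sup>2"
    by blast
  obtain \<psi> where \<psi>: "\<And>j. \<psi> j \<in> B2 \<Omega> K" "\<And>j. norm_V_inf \<Omega> V (\<psi> j) \<le> ennreal (e j)"
    "AE x in ?M. (\<lambda>j. \<psi> j x) \<longlonglongrightarrow> 0"
    using zero_capacity_sequence[OF \<Omega>(1) cap] unfolding e_def by blast
  have \<psi>2: "Ck_on 2 UNIV (\<psi> j)" for j
    using Ck_on_UNIV_of_C2_c[OF \<Omega>(1), of "\<psi> j"] \<psi>(1)[of j] by (simp add: B2_def)
  have \<psi>01: "0 \<le> \<psi> j x" "\<psi> j x \<le> 1" for j x using \<psi>(1)[of j] by (simp_all add: B2_def)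
  define \<kappa> where "\<kappa> = (\<lambda>j x. if ?d x \<le> e j then 1 else 0 :: real)"
  define u where "u = (\<lambda>j x. \<phi> x * \<theta> j x * (1 - \<psi> j x))"
  define A where "A = 8 * C * M + 2 * M"
  define err where "err = (\<lambda>j x. \<kappa> j x / e j + \<psi> j x + norm (gradient (\<psi> j) x) + \<bar>laplacian (\<psi> j) x\<bar>)"
  note meas = borel_measurable_lebesgue_on_of_continuous[OF \<Omega>(1)]
  have [measurable]: "\<psi> j \<in> borel_measurable ?M" "gradient (\<psi> j) \<in> borel_measurable ?M"
    "laplacian (\<psi> j) \<in> borel_measurable ?M" for j
    using Ck_on_2_continuous[OF \<psi>2] by (auto intro: meas)
  have [measurable]: "?d \<in> borel_measurable ?M"
    by (intro meas continuous_intros)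
  have [measurable]: "\<kappa> j \<in> borel_measurable ?M" for j unfolding \<kappa>_def by measurable
  have [measurable]: "err j \<in> borel_measurable ?M" for j unfolding err_def by measurable
  have A0: "0 \<le> A" using C0 M(1) by (simp add: A_def)
  have uC: "u j \<in> C2_c (\<Omega> - K)" for j
    unfolding u_def by (rule cutoff_product_in_C2_c[OF \<Omega>(1) K \<phi>2 \<theta>(1-3) \<psi>(1)])
  have est: "\<bar>u j x - \<phi> x\<bar> \<le> A * (\<kappa> j x + \<psi> j x)"
    "norm (gradient (u j) x - gradient \<phi> x) \<le> A * err j x"
    "\<bar>laplacian (u j) x - laplacian \<phi> x\<bar> \<le> A * err j x" if x: "x \<in> \<Omega>" for j x
    unfolding err_def
    by (rule cutoff_product_estimates[OF \<Omega>(1) x e(1,2) \<phi>2 M(2-5)[OF x] \<theta>(1,4-7) \<psi>2 \<psi>01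
        fun_cong[OF fun_cong[OF \<kappa>_def]] fun_cong[OF u_def] A_def]; simp)+
  have "(\<lambda>j. \<integral>\<^sup>+ x. ennreal (\<bar>g x\<bar> * \<bar>u j x - \<phi> x\<bar>) * V x \<partial>?M) \<longlonglongrightarrow> 0"
    "(\<lambda>j. \<integral>\<^sup>+ x. ennreal (\<bar>g x\<bar> * norm (gradient (u j) x - gradient \<phi> x)) \<partial>?M) \<longlonglongrightarrow> 0"
    "(\<lambda>j. \<integral>\<^sup>+ x. ennreal (\<bar>g x\<bar> * \<bar>laplacian (u j) x - laplacian \<phi> x\<bar>) \<partial>?M) \<longlonglongrightarrow> 0"
    if g: "g \<in> L1_V \<Omega> V" "g \<in> L1_0 \<Omega>" for g
  proof -
    note V[measurable]
    have [measurable]: "g \<in> borel_measurable ?M" using g(1) by (simp add: L1_V_def)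
    note lims = weighted_errors_tendsto_0[OF \<Omega>(1) V g \<psi>2 \<psi>01 e(1,3) \<psi>(2,3) frontier \<kappa>_def]
    have lim_err: "(\<lambda>j. \<integral>\<^sup>+ x. ennreal (\<bar>g x\<bar> * err j x) \<partial>?M) \<longlonglongrightarrow> 0"
      unfolding err_def by (rule lims(2))
    have conv: "(\<lambda>j. \<integral>\<^sup>+ x. F j x \<partial>?M) \<longlonglongrightarrow> 0"
      if F: "\<And>j x. x \<in> \<Omega> \<Longrightarrow> F j x \<le> ennreal A * G j x"
        and meas: "\<And>j. G j \<in> borel_measurable ?M"
        and G: "(\<lambda>j. \<integral>\<^sup>+ x. G j x \<partial>?M) \<longlonglongrightarrow> 0" for F G :: "nat \<Rightarrow> 'a \<Rightarrow> ennreal"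
    proof -
      have bd: "(\<integral>\<^sup>+ x. F j x \<partial>?M) \<le> ennreal A * (\<integral>\<^sup>+ x. G j x \<partial>?M)" for j
      proof -
        have "(\<integral>\<^sup>+ x. F j x \<partial>?M) \<le> (\<integral>\<^sup>+ x. ennreal A * G j x \<partial>?M)"
          by (intro nn_integral_mono F) simp
        also have "\<dots> = ennreal A * (\<integral>\<^sup>+ x. G j x \<partial>?M)"
          by (rule nn_integral_cmult) (rule meas)
        finally show ?thesis .
      qed
      have lim: "(\<lambda>j. ennreal A * (\<integral>\<^sup>+ x. G j x \<partial>?M)) \<longlonglongrightarrow> ennreal A * 0"
        by (intro ennreal_tendsto_cmult G) simp
      show ?thesis
        by (rule tendsto_sandwich[OF always_eventually always_eventually tendsto_const
              lim[unfolded mult_zero_right]]) (rule allI, simp, rule allI, rule bd)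
    qed
    show "(\<lambda>j. \<integral>\<^sup>+ x. ennreal (\<bar>g x\<bar> * \<bar>u j x - \<phi> x\<bar>) * V x \<partial>?M) \<longlonglongrightarrow> 0"
    proof (rule conv[OF _ _ lims(1)])
      fix j x assume x: "x \<in> \<Omega>"
      have "\<bar>g x\<bar> * \<bar>u j x - \<phi> x\<bar> \<le> A * ((\<kappa> j x + \<psi> j x) * \<bar>g x\<bar>)"
        using mult_left_mono[OF est(1)[OF x], of "\<bar>g x\<bar>" j] by (simp add: mult_ac)
      from ennreal_leI[OF this]
      have "ennreal (\<bar>g x\<bar> * \<bar>u j x - \<phi> x\<bar>) \<le> ennreal A * (ennreal (\<kappa> j x + \<psi> j x) * ennreal \<bar>g x\<bar>)"
        by (simp only: ennreal_mult'[OF A0] ennreal_mult''[OF abs_ge_zero])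
      from mult_right_mono[OF this, of "V x"]
      show "ennreal (\<bar>g x\<bar> * \<bar>u j x - \<phi> x\<bar>) * V x
          \<le> ennreal A * (ennreal (\<kappa> j x + \<psi> j x) * (ennreal \<bar>g x\<bar> * V x))"
        by (simp add: mult_ac)
    qed measurable
    have le: "ennreal (\<bar>g x\<bar> * y) \<le> ennreal A * ennreal (\<bar>g x\<bar> * err j x)" if "y \<le> A * err j x" for y j x
      using mult_left_mono[OF that, of "\<bar>g x\<bar>"] A0
      by (simp add: ennreal_mult'[symmetric] mult_ac ennreal_leI)
    show "(\<lambda>j. \<integral>\<^sup>+ x. ennreal (\<bar>g x\<bar> * norm (gradient (u j) x - gradient \<phi> x)) \<partial>?M) \<longlonglongrightarrow> 0"
      by (rule conv[OF _ _ lim_err]) (rule le[OF est(2)], assumption, measurable)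
    show "(\<lambda>j. \<integral>\<^sup>+ x. ennreal (\<bar>g x\<bar> * \<bar>laplacian (u j) x - laplacian \<phi> x\<bar>) \<partial>?M) \<longlonglongrightarrow> 0"
      by (rule conv[OF _ _ lim_err]) (rule le[OF est(3)], assumption, measurable)
  qed
  moreover have "u j \<in> C2_0 \<Omega>" for j
    using C2_c_subset_C2_0[of "\<Omega> - K" \<Omega>] uC[of j] \<Omega>(1) compact_imp_closed[OF K] by auto
  ultimately have "weakly_strongly_converges \<Omega> V u \<phi>"
    using \<phi> unfolding weakly_strongly_converges_def by blast
  then show ?thesis using uC by blast
qed

theorem theorem5:
  fixes \<Omega> K :: "(real ^ 'n) set" and V :: "real ^ 'n \<Rightarrow> ennreal"
  assumes "smooth_bounded_domain \<Omega>"
    and "compact K" and "K \<subseteq> \<Omega>"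
    and "potential \<Omega> V"
    and "Cap_V_inf \<Omega> V K = 0"
  shows "\<forall>\<phi> \<in> C2_0 \<Omega>. \<exists>\<phi>s. (\<forall>j. \<phi>s j \<in> C2_c (\<Omega> - K)) \<and>
    weakly_strongly_converges \<Omega> V \<phi>s \<phi>"
  using assms by (intro ballI weakly_strongly_dense) (auto simp: smooth_bounded_domain_def potential_def)

end
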